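(* Let $P$ be a finite pure poset with rank $r$. Let $k_i$ denote the number of connected components of rank $i$ for $i=0,\ldots,r-1$. Then the Krull dimension of the chain algebra is $$\dim\mathbb{K}[C_P]=|P|-(k_0+\cdots+k_{r-1}).$$
   Context: $\mathbb{K}$ is a field. The length of a chain $C$ in a finite poset is $|C|-1$. A finite poset $P$ is pure of rank $r$ if every maximal chain of $P$ has length $r$. For $x<y$ in $P$, $y$ covers $x$ if there is no $z$ with $x<z<y$. A pure poset has a unique rank function $\rho$ with $\rho(m)=0$ for minimal $m$ and $\rho(y)=\rho(x)+1$ whenever $y$ covers $x$. Set $P_i=\{a\in P: \rho(a)=i\}$ for $0\le i\le r$. To each maximal chain $C: x_0<x_1<\cdots<x_r$ associate the monomial $x_C=x_0x_1\cdots x_r$ in the polynomial ring $\mathbb{K}[x : x\in P]$. The chain algebra $\mathbb{K}[C_P]$ is the $\mathbb{K}$-subalgebra generated by all $x_C$, with $C$ a maximal chain of $P$. For $0\le i\le r-1$, $G_i(P)$ is the bipartite graph with partition $(P_i,P_{i+1})$ in which $a\in P_i$ and $b\in P_{i+1}$ are adjacent iff $b$ covers $a$. Let $G_{i,1},\ldots,G_{i,k_i}$ be the connected components of the graph $G_i(P)$; the sets $P_{i,j}=V(G_{i,j})\cap P_i$, $j=1,\dots,k_i$, are called the connected components of rank $i$ (so $k_i$ is the number of connected components of $G_i(P)$). *)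

theory Defs
  imports
    "HOL-Algebra.Ideal"
    "HOL-Algebra.Embedded_Algebras"
    "HOL-Library.Poly_Mapping"
    "HOL-Library.Extended_Real"
    "Graph_Theory.Graph_Theory"
begin

section \<open>Pure posets and their rank function\<close>

text \<open>A finite poset is a finite set \<open>P\<close> of elements of an ordered type, with the induced order.\<close>

definition maximal_chains :: "'a::order set \<Rightarrow> 'a set set" where
  "maximal_chains P = {C. pred_on.maxchain P (<) C}"

text \<open>
  The length of a chain \<open>C\<close> is \<open>card C - 1\<close>; the condition is written without truncated
  subtraction, so the empty poset is not pure of any rank \<open>r\<close>.
\<close>

definition pure_of_rank :: "'a::order set \<Rightarrow> nat \<Rightarrow> bool" where
  "pure_of_rank P r \<longleftrightarrow> (\<forall>C\<in>maximal_chains P. card C = r + 1)"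

definition covers :: "'a::order set \<Rightarrow> 'a \<Rightarrow> 'a \<Rightarrow> bool" where
  "covers P y x \<longleftrightarrow> x \<in> P \<and> y \<in> P \<and> x < y \<and> \<not> (\<exists>z\<in>P. x < z \<and> z < y)"

definition minimal_in :: "'a::order set \<Rightarrow> 'a \<Rightarrow> bool" where
  "minimal_in P m \<longleftrightarrow> m \<in> P \<and> \<not> (\<exists>x\<in>P. x < m)"

text \<open>
  The membership in \<^const>\<open>extensional\<close> fixes the values outside \<open>P\<close>, so that the rank
  function is unique as a function on the whole type.
\<close>

definition is_rank_function :: "'a::order set \<Rightarrow> ('a \<Rightarrow> nat) \<Rightarrow> bool" where
  "is_rank_function P \<rho> \<longleftrightarrow> \<rho> \<in> extensional P \<and>
     (\<forall>m. minimal_in P m \<longrightarrow> \<rho> m = 0) \<and>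
     (\<forall>x y. covers P y x \<longrightarrow> \<rho> y = \<rho> x + 1)"

definition rank_function :: "'a::order set \<Rightarrow> 'a \<Rightarrow> nat" where
  "rank_function P = (THE \<rho>. is_rank_function P \<rho>)"

definition rank_level :: "'a::order set \<Rightarrow> nat \<Rightarrow> 'a set" where
  "rank_level P i = {a \<in> P. rank_function P a = i}"


section \<open>The graphs between consecutive ranks\<close>

text \<open>
  Graphs are symmetric digraphs: every edge is a pair of opposite arcs. The connected components
  of such a graph are its strongly connected components.
\<close>

definition cover_graph :: "'a::order set \<Rightarrow> nat \<Rightarrow> 'a pair_pre_digraph" where
  "cover_graph P i =
    \<lparr> pverts = rank_level P i \<union> rank_level P (i + 1),
      parcs = (let E = {(a, b). a \<in> rank_level P i \<and> b \<in> rank_level P (i + 1) \<and> covers P b a}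
               in E \<union> E\<inverse>) \<rparr>"

definition rank_components :: "'a::order set \<Rightarrow> nat \<Rightarrow> 'a set set" where
  "rank_components P i =
     (\<lambda>H. verts H \<inter> rank_level P i) ` pre_digraph.sccs (with_proj (cover_graph P i))"


section \<open>The chain algebra\<close>

text \<open>
  The type \<open>('a \<Rightarrow>\<^sub>0 nat) \<Rightarrow>\<^sub>0 'k\<close> is the polynomial ring over \<open>'k\<close> with one variable for each
  element of \<open>'a\<close>: exponent vectors are mapped to coefficients, and multiplication is convolution.
  The chain algebra of \<open>P\<close> lies in the subring of polynomials in the variables from \<open>P\<close>.
\<close>

definition poly_ring :: "(('a \<Rightarrow>\<^sub>0 nat) \<Rightarrow>\<^sub>0 'k::comm_ring_1) ring" where
  "poly_ring = \<lparr> carrier = UNIV, monoid.mult = (*), one = 1, ring.zero = 0, add = (+) \<rparr>"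

definition poly_const :: "'k \<Rightarrow> ('a \<Rightarrow>\<^sub>0 nat) \<Rightarrow>\<^sub>0 'k::comm_ring_1" where
  "poly_const c = Poly_Mapping.single 0 c"

definition poly_var :: "'a \<Rightarrow> ('a \<Rightarrow>\<^sub>0 nat) \<Rightarrow>\<^sub>0 'k::comm_ring_1" where
  "poly_var x = Poly_Mapping.single (Poly_Mapping.single x 1) 1"

definition chain_monomial :: "'a set \<Rightarrow> ('a \<Rightarrow>\<^sub>0 nat) \<Rightarrow>\<^sub>0 'k::comm_ring_1" where
  "chain_monomial C = (\<Prod>x\<in>C. poly_var x)"

text \<open>
  The library's \<^const>\<open>subalgebra\<close> only demands closure under addition and under multiplication
  by scalars, so a subalgebra in the usual sense is in addition a \<^const>\<open>subring\<close>.
\<close>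

definition generated_subalgebra :: "'b set \<Rightarrow> ('b, 'm) ring_scheme \<Rightarrow> 'b set \<Rightarrow> 'b set" where
  "generated_subalgebra K R S = (\<lambda>A. subring A R \<and> subalgebra K A R) hull S"

definition chain_algebra :: "'a::order set \<Rightarrow> (('a \<Rightarrow>\<^sub>0 nat) \<Rightarrow>\<^sub>0 'k::field) ring" where
  "chain_algebra P =
     poly_ring
       \<lparr> carrier := generated_subalgebra (range poly_const) poly_ring
                     (chain_monomial ` maximal_chains P) \<rparr>"


section \<open>Krull dimension\<close>

text \<open>
  The supremum of the lengths of finite nonempty chains of prime ideals. It is \<open>-\<infinity>\<close> for the
  zero ring.
\<close>

definition krull_dim :: "('b, 'm) ring_scheme \<Rightarrow> ereal" where
  "krull_dim R =
     (SUP \<C>\<in>{\<C>. finite \<C> \<and> \<C> \<noteq> {} \<and> subset.chain {I. primeideal I R} \<C>}.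
        ereal (real (card \<C>) - 1))"


section \<open>Well-definedness\<close>

lemma exists_maximal_chain:
  fixes P :: "'a::order set"
  shows "\<exists>C. C \<in> maximal_chains P"
  unfolding maximal_chains_def using pred_on.Hausdorff by blast

lemma maximal_chains_iff:
  fixes P :: "'a::order set"
  shows "C \<in> maximal_chains P \<longleftrightarrow>
    C \<subseteq> P \<and> (\<forall>a\<in>C. \<forall>b\<in>C. a \<le> b \<or> b \<le> a) \<and>
    (\<forall>S. S \<subseteq> P \<longrightarrow> (\<forall>a\<in>S. \<forall>b\<in>S. a \<le> b \<or> b \<le> a) \<longrightarrow> C \<subseteq> S \<longrightarrow> S = C)"
proof -
  have le: "(<)\<^sup>=\<^sup>= = ((\<le>) :: 'a \<Rightarrow> 'a \<Rightarrow> bool)"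
    by (intro ext) (simp add: le_less)
  define Q where "Q S \<longleftrightarrow> S \<subseteq> P \<and> (\<forall>a\<in>S. \<forall>b\<in>S. a \<le> b \<or> b \<le> a)" for S
  have "pred_on.chain P (<) S \<longleftrightarrow> Q S" for S
    unfolding pred_on.chain_def le Q_def ..
  then have "C \<in> maximal_chains P \<longleftrightarrow> Q C \<and> \<not> (\<exists>S. Q S \<and> C \<subset> S)"
    by (simp only: maximal_chains_def pred_on.maxchain_def mem_Collect_eq)
  also have "\<dots> \<longleftrightarrow> Q C \<and> (\<forall>S. Q S \<longrightarrow> C \<subseteq> S \<longrightarrow> S = C)"
    unfolding psubset_eq by blast
  finally show ?thesis
    by (simp only: Q_def conj_assoc imp_conjL)
qed

lemma maximal_chain_glue:
  fixes P :: "'a::order set"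
  assumes x: "x \<in> P" and C: "C \<in> maximal_chains {y\<in>P. y < x}"
    and D: "D \<in> maximal_chains {y\<in>P. x \<le> y}"
  shows "C \<union> D \<in> maximal_chains P" "C \<inter> D = {}"
proof -
  note C' = C[unfolded maximal_chains_iff]
  have C1: "C \<subseteq> {y\<in>P. y < x}" "\<forall>a\<in>C. \<forall>b\<in>C. a \<le> b \<or> b \<le> a"
    by (rule C'[THEN conjunct1], rule C'[THEN conjunct2, THEN conjunct1])
  have C2: "S = C"
    if "S \<subseteq> {y\<in>P. y < x}" "\<forall>a\<in>S. \<forall>b\<in>S. a \<le> b \<or> b \<le> a" "C \<subseteq> S" for S
    by (rule C'[THEN conjunct2, THEN conjunct2, THEN spec, THEN mp, THEN mp, THEN mp, OF that])
  note D' = D[unfolded maximal_chains_iff]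
  have D1: "D \<subseteq> {y\<in>P. x \<le> y}" "\<forall>a\<in>D. \<forall>b\<in>D. a \<le> b \<or> b \<le> a"
    by (rule D'[THEN conjunct1], rule D'[THEN conjunct2, THEN conjunct1])
  have D2: "S = D"
    if "S \<subseteq> {y\<in>P. x \<le> y}" "\<forall>a\<in>S. \<forall>b\<in>S. a \<le> b \<or> b \<le> a" "D \<subseteq> S" for S
    by (rule D'[THEN conjunct2, THEN conjunct2, THEN spec, THEN mp, THEN mp, THEN mp, OF that])
  show "C \<inter> D = {}" using C1(1) D1(1) by fastforce
  have Px: "x \<in> {y\<in>P. x \<le> y}" using x by simp
  have "insert x D = D"
  proof (rule D2)
    show "insert x D \<subseteq> {y\<in>P. x \<le> y}" using Px D1(1) by (rule insert_subsetI)
    have "x \<le> d" if "d \<in> D" for d using that D1(1) by auto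
    then show "\<forall>a\<in>insert x D. \<forall>b\<in>insert x D. a \<le> b \<or> b \<le> a" using D1(2) by simp
  qed (rule subset_insertI)
  then have xD: "x \<in> D" by blast
  have lt: "c \<le> d" if "c \<in> C" "d \<in> D" for c d
  proof -
    have "c < x" "x \<le> d" using that C1(1) D1(1) by auto
    then show ?thesis by simp
  qed
  have ch: "\<forall>a\<in>C \<union> D. \<forall>b\<in>C \<union> D. a \<le> b \<or> b \<le> a"
    using C1(2) D1(2) lt by (simp add: ball_Un)
  have mx: "S = C \<union> D"
    if S: "S \<subseteq> P" "\<forall>a\<in>S. \<forall>b\<in>S. a \<le> b \<or> b \<le> a" "C \<union> D \<subseteq> S" for S
  proof -
    have sub: "\<forall>a\<in>S \<inter> Q. \<forall>b\<in>S \<inter> Q. a \<le> b \<or> b \<le> a" for Q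
      using S(2) by simp
    have "S \<inter> {y\<in>P. y < x} = C"
    proof (rule C2[OF Int_lower2 sub])
      show "C \<subseteq> S \<inter> {y\<in>P. y < x}" using S(3) C1(1) by simp
    qed
    moreover have "S \<inter> {y\<in>P. x \<le> y} = D"
    proof (rule D2[OF Int_lower2 sub])
      show "D \<subseteq> S \<inter> {y\<in>P. x \<le> y}" using S(3) D1(1) by simp
    qed
    moreover have "S \<subseteq> {y\<in>P. y < x} \<union> {y\<in>P. x \<le> y}"
    proof
      fix y assume y: "y \<in> S"
      have "x \<in> S" using xD S(3) by auto
      with y S(2) have "y \<le> x \<or> x \<le> y" by simp
      moreover have "y \<in> P" using y S(1) by auto
      ultimately show "y \<in> {y\<in>P. y < x} \<union> {y\<in>P. x \<le> y}"
        by (auto simp: le_less)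
    qed
    ultimately show ?thesis by (metis Int_Un_distrib Int_absorb2)
  qed
  have "C \<union> D \<subseteq> P" using C1(1) D1(1) by blast
  with ch mx show "C \<union> D \<in> maximal_chains P"
    unfolding maximal_chains_iff by simp
qed

lemma finite_maximal_chain:
  fixes P :: "'a::order set"
  assumes "finite P" "C \<in> maximal_chains P"
  shows "finite C" "C \<subseteq> P"
  using assms by (auto simp: maximal_chains_iff intro: finite_subset)

lemma card_maximal_chain_below:
  fixes P :: "'a::order set"
  assumes P: "finite P" "pure_of_rank P r" and x: "x \<in> P"
    and C: "C \<in> maximal_chains {y\<in>P. y < x}" and C': "C' \<in> maximal_chains {y\<in>P. y < x}"
  shows "card C = card C'"
proof -
  obtain D where D: "D \<in> maximal_chains {y\<in>P. x \<le> y}"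
    using exists_maximal_chain by blast
  have fD: "finite D" using finite_maximal_chain[OF _ D] P(1) by auto
  have "card B + card D = r + 1" if B: "B \<in> maximal_chains {y\<in>P. y < x}" for B
  proof -
    have "finite B" using finite_maximal_chain[OF _ B] P(1) by auto
    then have "card (B \<union> D) = card B + card D"
      using maximal_chain_glue(2)[OF x B D] fD by (simp add: card_Un_disjoint)
    moreover have "card (B \<union> D) = r + 1"
      using maximal_chain_glue(1)[OF x B D] P(2) unfolding pure_of_rank_def by blast
    ultimately show ?thesis by simp
  qed
  from this[OF C] this[OF C'] show ?thesis by simp
qed

lemma maximal_chain_insert_cover:
  fixes P :: "'a::order set"
  assumes cov: "covers P y x" and C: "C \<in> maximal_chains {z\<in>P. z < x}"
  shows "insert x C \<in> maximal_chains {z\<in>P. z < y}"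
proof -
  let ?Q = "{z\<in>P. z < y}"
  have x: "x \<in> ?Q" using cov by (auto simp: covers_def)
  have 1: "{z\<in>?Q. z < x} = {z\<in>P. z < x}" and 2: "{z\<in>?Q. x \<le> z} = {x}"
    using cov by (auto simp: covers_def le_less intro: less_trans)
  have "{x} \<in> maximal_chains {x}"
    by (auto simp: maximal_chains_iff)
  then have "C \<union> {x} \<in> maximal_chains ?Q"
    by (intro maximal_chain_glue(1)[OF x]) (simp_all only: 1 2 C)
  then show ?thesis by simp
qed

lemma exists_covered:
  fixes P :: "'a::order set"
  assumes "finite P" "y \<in> P" "\<not> minimal_in P y"
  shows "\<exists>x. covers P y x"
proof -
  let ?B = "{x\<in>P. x < y}"
  have "finite ?B" "?B \<noteq> {}" using assms by (auto simp: minimal_in_def)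
  then obtain m where "m \<in> ?B" "\<forall>b\<in>?B. m \<le> b \<longrightarrow> m = b"
    using finite_has_maximal[of ?B] by blast
  then have "covers P y m" using assms(2) by (auto simp: covers_def)
  then show ?thesis ..
qed

proposition ex1_rank_function:
  fixes P :: "'a::order set"
  assumes P: "finite P" "pure_of_rank P r"
  shows "\<exists>!\<rho>. is_rank_function P \<rho>"
proof (rule ex_ex1I)
  define M where "M x = (SOME C. C \<in> maximal_chains {y\<in>P. y < x})" for x
  have M: "M x \<in> maximal_chains {y\<in>P. y < x}" for x
    unfolding M_def by (rule someI_ex) (rule exists_maximal_chain)
  define \<rho> where "\<rho> = restrict (\<lambda>x. card (M x)) P"
  have "\<rho> m = 0" if m: "minimal_in P m" for m
  proof -
    have "{y\<in>P. y < m} = {}" using m by (auto simp: minimal_in_def)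
    moreover have "M m \<subseteq> {y\<in>P. y < m}"
      by (rule finite_maximal_chain(2)[OF _ M]) (use P(1) in simp)
    ultimately have "M m \<subseteq> {}" by (simp only:)
    then show ?thesis using m by (auto simp: \<rho>_def minimal_in_def)
  qed
  moreover have "\<rho> y = \<rho> x + 1" if cov: "covers P y x" for x y
  proof -
    have xy: "x \<in> P" "y \<in> P" using cov by (auto simp: covers_def)
    have fin: "finite (M x)" "x \<notin> M x"
      using finite_maximal_chain[OF _ M[of x]] P(1) by auto
    have "card (M y) = card (insert x (M x))"
      by (rule card_maximal_chain_below[OF P xy(2) M maximal_chain_insert_cover[OF cov M]])
    then show ?thesis using fin xy by (simp add: \<rho>_def)
  qed
  moreover have "\<rho> \<in> extensional P" by (simp add: \<rho>_def)
  ultimately have "is_rank_function P \<rho>" unfolding is_rank_function_def by blast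
  then show "\<exists>\<rho>. is_rank_function P \<rho>" by (rule exI[of _ \<rho>])
next
  fix \<rho> \<sigma> assume \<rho>: "is_rank_function P \<rho>" and \<sigma>: "is_rank_function P \<sigma>"
  have "\<rho> x = \<sigma> x" if "x \<in> P" for x
    using that
  proof (induction "card {y\<in>P. y < x}" arbitrary: x rule: less_induct)
    case less
    show ?case
    proof (cases "minimal_in P x")
      case True
      then show ?thesis using \<rho> \<sigma> by (simp add: is_rank_function_def)
    next
      case False
      then obtain w where w: "covers P x w" using exists_covered P(1) less.prems by blast
      then have "w \<in> P" "w < x" by (auto simp: covers_def)
      then have "{y\<in>P. y < w} \<subset> {y\<in>P. y < x}" by (auto intro: less_trans)
      then have "card {y\<in>P. y < w} < card {y\<in>P. y < x}"
        using P(1) by (intro psubset_card_mono) auto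
      then have "\<rho> w = \<sigma> w" using less.hyps \<open>w \<in> P\<close> by blast
      then show ?thesis using \<rho> \<sigma> w by (simp add: is_rank_function_def)
    qed
  qed
  then show "\<rho> = \<sigma>"
    using \<rho> \<sigma> unfolding is_rank_function_def by (metis extensionalityI)
qed

lemma is_rank_function_rank_function:
  fixes P :: "'a::order set"
  assumes "finite P" "pure_of_rank P r"
  shows "is_rank_function P (rank_function P)"
  unfolding rank_function_def by (rule theI'[OF ex1_rank_function[OF assms]])

lemma card_rank_components:
  fixes P :: "'a::order set"
  assumes P: "finite P" "pure_of_rank P r"
  shows "card (rank_components P i) = card (pre_digraph.sccs (with_proj (cover_graph P i)))"
proof -
  let ?G = "with_proj (cover_graph P i)"
  interpret pair_wf_digraph "cover_graph P i"
    by unfold_locales (auto simp: cover_graph_def Let_def)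
  have disj: "verts H \<inter> verts H' = {}" if "H \<in> sccs" "H' \<in> sccs" "verts H \<noteq> verts H'" for H H'
    using that sccs_verts_disjoint in_sccs_vertsI_sccs by (metis imageI)
  have ne: "\<exists>a\<in>verts H. a \<in> rank_level P i" if H: "H \<in> sccs" for H
  proof -
    from H have S: "verts H \<in> sccs_verts" using in_sccs_vertsI_sccs by blast
    then obtain b where b: "b \<in> verts H" unfolding in_sccs_verts_conv_reachable by auto
    moreover have "verts H \<subseteq> pverts (cover_graph P i)"
      using in_sccs_imp_induced[OF H] unfolding induced_subgraph_def subgraph_def by simp
    ultimately consider "b \<in> rank_level P i" | "b \<in> rank_level P (i + 1)"
      by (auto simp: cover_graph_def)
    then show ?thesis
    proof cases
      case 2
      note rk = is_rank_function_rank_function[OF P]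
      have "\<not> minimal_in P b" "b \<in> P"
        using 2 rk by (auto simp: rank_level_def is_rank_function_def)
      then obtain a where a: "covers P b a" using exists_covered P(1) by blast
      then have a': "a \<in> rank_level P i"
        using 2 rk by (auto simp: rank_level_def is_rank_function_def covers_def)
      have "(a, b) \<in> parcs (cover_graph P i)" "(b, a) \<in> parcs (cover_graph P i)"
        using a a' 2 by (auto simp: cover_graph_def Let_def)
      then have "b \<rightarrow>\<^sup>*\<^bsub>?G\<^esub> a" "a \<rightarrow>\<^sup>*\<^bsub>?G\<^esub> b" by (auto intro: adj_reachable_trans)
      then have "a \<in> verts H"
        using S b unfolding in_sccs_verts_conv_reachable by blast
      with a' show ?thesis by blast
    qed (use b in blast)
  qed
  have "inj_on (\<lambda>H. verts H \<inter> rank_level P i) sccs"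
  proof (rule inj_onI)
    fix H H' assume H: "H \<in> sccs" "H' \<in> sccs"
      and eq: "verts H \<inter> rank_level P i = verts H' \<inter> rank_level P i"
    then have "verts H = verts H'" using disj[of H H'] ne[of H] by blast
    then show "H = H'"
      by (rule induced_eq_verts_imp_eq[OF H[THEN in_sccs_imp_induced]])
  qed
  then show ?thesis
    by (simp add: rank_components_def card_image)
qed

lemma cring_poly_ring: "cring (poly_ring :: (('a \<Rightarrow>\<^sub>0 nat) \<Rightarrow>\<^sub>0 'k::comm_ring_1) ring)"
proof -
  have "\<exists>y. x + y = 0" for x :: "('a \<Rightarrow>\<^sub>0 nat) \<Rightarrow>\<^sub>0 'k"
    using add.right_inverse by blast
  then show ?thesis
    unfolding poly_ring_def by unfold_locales (auto simp: algebra_simps Units_def)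
qed

lemma cring_chain_algebra: "cring (chain_algebra P :: (('a::order \<Rightarrow>\<^sub>0 nat) \<Rightarrow>\<^sub>0 'k::field) ring)"
proof -
  let ?R = "poly_ring :: (('a \<Rightarrow>\<^sub>0 nat) \<Rightarrow>\<^sub>0 'k) ring"
  interpret R: cring ?R by (rule cring_poly_ring)
  have carr: "carrier ?R = UNIV" by (simp add: poly_ring_def)
  let ?A = "generated_subalgebra (range poly_const) ?R (chain_monomial ` maximal_chains P)"
  have "subring ?A ?R"
    by (rule R.subringI)
      (auto simp: carr generated_subalgebra_def hull_def dest: subringE(3-7))
  then have "subcring ?A ?R"
    by (intro R.subcringI') (auto simp: carr R.m_comm)
  then show ?thesis
    unfolding chain_algebra_def using R.subcring_iff[of ?A] by (simp add: carr)
qed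

end

theory Submission
  imports Defs
begin

text \<open>
  Choose in every component of \<open>G\<^sub>i(P)\<close> one element of rank \<open>i + 1\<close> (a pivot), and let \<open>S\<close> be the
  set of all other elements of \<open>P\<close>. A maximal chain meets a component of \<open>G\<^sub>i(P)\<close> either in both
  ranks or not at all. So the exponents of a monomial of \<open>K[C\<^sub>P]\<close> have equal sums over the two sides
  of each component, and its exponents at \<open>S\<close> determine the exponents at the pivots, rank by rank.
  Counting monomials then shows that more than \<open>card S\<close> elements are algebraically dependent, which
  bounds the length of chains of primes: elements \<open>x\<^sub>i \<in> p\<^sub>i\<^sub>+\<^sub>1 - p\<^sub>i\<close> for primes
  \<open>p\<^sub>0 \<subset> \<dots> \<subset> p\<^sub>n\<close> are algebraically independent. Conversely, modulo the coordinates at the pivots,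
  the indicators of maximal chains generate \<open>\<int>\<^sup>S\<close>. Hence, for \<open>T \<subseteq> S\<close>, the prime ideals of the
  polynomials that vanish after setting all variables outside \<open>T\<close> to 1 become strictly smaller
  with growing \<open>T\<close>.
\<close>

section \<open>Ranks, covers and components\<close>

locale pure_poset =
  fixes P :: "'a::order set" and r :: nat
  assumes fin: "finite P" and pure: "pure_of_rank P r"
begin

section \<open>Rank along maximal chains\<close>

abbreviation rk :: "'a \<Rightarrow> nat" where "rk \<equiv> rank_function P"

lemma rk_minimal: "minimal_in P x \<Longrightarrow> rk x = 0"
  and rk_covers: "covers P y x \<Longrightarrow> rk y = rk x + 1"
  using is_rank_function_rank_function[OF fin pure] by (auto simp: is_rank_function_def)

lemma finite_chain:
  assumes "C \<in> maximal_chains {y \<in> P. Q y}"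
  shows "finite C" "C \<subseteq> {y \<in> P. Q y}"
  using finite_maximal_chain[OF _ assms] fin by auto

text \<open>Appending \<open>w\<close>, covered by \<open>x\<close>, to a maximal chain below
  \<open>w\<close> gives a maximal chain below \<open>x\<close>, and by purity all maximal chains
  below \<open>x\<close> have the same size.\<close>

lemma card_chain_below:
  assumes "x \<in> P" "C \<in> maximal_chains {y \<in> P. y < x}"
  shows "card C = rk x"
  using assms
proof (induction "card {y \<in> P. y < x}" arbitrary: x C rule: less_induct)
  case less
  show ?case
  proof (cases "minimal_in P x")
    case True
    then have "C = {}" using finite_chain[OF less.prems(2)] by (auto simp: minimal_in_def)
    then show ?thesis using rk_minimal[OF True] by simp
  next
    case False
    then obtain w where w: "covers P x w" using exists_covered[OF fin less.prems(1)] by blast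
    then have wP: "w \<in> P" "w < x" by (auto simp: covers_def)
    then have "{y \<in> P. y < w} \<subset> {y \<in> P. y < x}" by (auto intro: less_trans)
    then have lt: "card {y \<in> P. y < w} < card {y \<in> P. y < x}"
      using fin by (intro psubset_card_mono) auto
    obtain D where D: "D \<in> maximal_chains {y \<in> P. y < w}" using exists_maximal_chain by blast
    have "card C = card (insert w D)"
      by (rule card_maximal_chain_below[OF fin pure less.prems maximal_chain_insert_cover[OF w D]])
    also have "\<dots> = card D + 1" using finite_chain[OF D] by (subst card_insert_disjoint) auto
    finally show ?thesis using less.hyps[OF lt wP(1) D] rk_covers[OF w] by simp
  qed
qed

text \<open>Glued to a maximal chain strictly below \<open>x\<close>, which has \<open>rk x\<close>
  elements, \<open>D\<close> becomes a maximal chain of \<open>P\<close>.\<close>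

lemma card_chain_above:
  assumes x: "x \<in> P" and D: "D \<in> maximal_chains {y \<in> P. x \<le> y}"
  shows "rk x + card D = r + 1"
proof -
  obtain C where C: "C \<in> maximal_chains {y \<in> P. y < x}" using exists_maximal_chain by blast
  have "card (C \<union> D) = card C + card D"
    by (rule card_Un_disjoint[OF finite_chain(1)[OF C] finite_chain(1)[OF D] maximal_chain_glue(2)[OF x C D]])
  then show ?thesis
    using maximal_chain_glue(1)[OF x C D] pure card_chain_below[OF x C] by (auto simp: pure_of_rank_def)
qed

lemma base_mem_chain_above:
  assumes x: "x \<in> P" and D: "D \<in> maximal_chains {y \<in> P. x \<le> y}"
  shows "x \<in> D"
proof -
  have "insert x D = D"
    using D[unfolded maximal_chains_iff] x by (auto simp: subset_iff)
  then show ?thesis by blast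
qed

lemma rk_le:
  assumes x: "x \<in> P"
  shows "rk x \<le> r"
proof -
  obtain D where D: "D \<in> maximal_chains {y \<in> P. x \<le> y}" using exists_maximal_chain by blast
  have "card D \<noteq> 0" using base_mem_chain_above[OF x D] finite_chain(1)[OF D] by auto
  then show ?thesis using card_chain_above[OF x D] by linarith
qed

text \<open>A maximal chain below \<open>y\<close> chosen through \<open>x\<close> has
  \<open>rk y\<close> elements; \<open>rk x\<close> of them lie below \<open>x\<close>, and
  \<open>x\<close> itself is one more.\<close>

lemma rk_strict_mono:
  assumes x: "x \<in> P" and y: "y \<in> P" and xy: "x < y"
  shows "rk x < rk y"
proof -
  let ?Q = "{z \<in> P. z < y}"
  have xQ: "x \<in> ?Q" using x xy by simp
  obtain C where C: "C \<in> maximal_chains {z \<in> ?Q. z < x}" using exists_maximal_chain by blast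
  obtain D where D: "D \<in> maximal_chains {z \<in> ?Q. x \<le> z}" using exists_maximal_chain by blast
  have "{z \<in> ?Q. z < x} = {z \<in> P. z < x}" using xy by (auto intro: less_trans)
  then have C': "C \<in> maximal_chains {z \<in> P. z < x}" using C by simp
  have fD: "finite D" using finite_maximal_chain[OF _ D] fin by auto
  have "insert x D = D"
    using D[unfolded maximal_chains_iff] xQ by (auto simp: subset_iff)
  then have "D \<noteq> {}" by blast
  with fD have "card D > 0" by (simp add: card_gt_0_iff)
  moreover have "card (C \<union> D) = card C + card D"
    by (rule card_Un_disjoint[OF finite_chain(1)[OF C'] fD maximal_chain_glue(2)[OF xQ C D]])
  moreover have "card (C \<union> D) = rk y"
    by (rule card_chain_below[OF y maximal_chain_glue(1)[OF xQ C D]])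
  ultimately show ?thesis using card_chain_below[OF x C'] by simp
qed

text \<open>Ranks strictly increase along a chain, and purity supplies \<open>r + 1\<close> elements
  for the \<open>r + 1\<close> possible ranks.\<close>

lemma bij_betw_rk:
  assumes C: "C \<in> maximal_chains P"
  shows "bij_betw rk C {..r}"
proof -
  have CP: "C \<subseteq> P" "finite C" using finite_maximal_chain[OF fin C] by auto
  have cmp: "a \<le> b \<or> b \<le> a" if "a \<in> C" "b \<in> C" for a b
    using C that by (auto simp: maximal_chains_iff)
  have inj: "inj_on rk C"
  proof (rule inj_onI)
    fix a b assume ab: "a \<in> C" "b \<in> C" "rk a = rk b"
    then show "a = b" using cmp[OF ab(1,2)] rk_strict_mono[of a b] rk_strict_mono[of b a] CP
      by (auto simp: le_less)
  qed
  moreover have "rk ` C = {..r}"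
  proof (rule card_subset_eq)
    show "rk ` C \<subseteq> {..r}" using rk_le CP by auto
    show "card (rk ` C) = card {..r}"
      using C pure card_image[OF inj] by (auto simp: pure_of_rank_def)
  qed simp
  ultimately show ?thesis by (simp add: bij_betw_def)
qed

lemma maximal_chain_covers:
  assumes C: "C \<in> maximal_chains P" and ab: "a \<in> C" "b \<in> C" "rk b = rk a + 1"
  shows "covers P b a"
proof -
  have CP: "a \<in> P" "b \<in> P" using finite_maximal_chain[OF fin C] ab by auto
  have "a \<le> b \<or> b \<le> a" using C ab by (auto simp: maximal_chains_iff)
  then have "a < b" using rk_strict_mono[of b a] CP ab(3) by (auto simp: le_less)
  moreover have False if "z \<in> P" "a < z" "z < b" for z
    using rk_strict_mono[of a z] rk_strict_mono[of z b] that CP ab(3) by simp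
  ultimately show ?thesis using CP by (auto simp: covers_def)
qed

text \<open>In a maximal chain of \<open>P\<close> through \<open>x\<close>, the element of the next
  rank covers \<open>x\<close>.\<close>

lemma exists_cover:
  assumes x: "x \<in> P" and "rk x < r"
  shows "\<exists>y. covers P y x"
proof -
  obtain C where C: "C \<in> maximal_chains {y \<in> P. y < x}" using exists_maximal_chain by blast
  obtain D where D: "D \<in> maximal_chains {y \<in> P. x \<le> y}" using exists_maximal_chain by blast
  note CD = maximal_chain_glue(1)[OF x C D]
  have "rk ` (C \<union> D) = {..r}" using bij_betw_rk[OF CD] by (simp add: bij_betw_def)
  then have "rk x + 1 \<in> rk ` (C \<union> D)" using assms(2) by simp
  then obtain y where "y \<in> C \<union> D" "rk y = rk x + 1" by (metis imageE)
  then show ?thesis using maximal_chain_covers[OF CD] base_mem_chain_above[OF x D] by blast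
qed

lemma exists_covered_of_rk_pos: "y \<in> P \<Longrightarrow> 0 < rk y \<Longrightarrow> \<exists>x. covers P y x"
  using exists_covered[OF fin] rk_minimal by fastforce

section \<open>Components of the cover graphs\<close>

definition comps :: "nat \<Rightarrow> 'a set set" where
  "comps i = pre_digraph.sccs_verts (with_proj (cover_graph P i))"

lemma wf_cover_graph: "pair_wf_digraph (cover_graph P i)"
  by unfold_locales (auto simp: cover_graph_def Let_def)

text \<open>\<open>comps\<close> keeps both ranks of a component, as the balance equations compare
  them; the count is still that of \<open>rank_components\<close>.\<close>

lemma card_comps: "card (rank_components P i) = card (comps i)"
proof -
  interpret pair_wf_digraph "cover_graph P i" by (rule wf_cover_graph)
  show ?thesis
    unfolding card_rank_components[OF fin pure] comps_def by (rule card_sccs_verts[symmetric])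
qed

lemma comps_subset: "H \<in> comps i \<Longrightarrow> H \<subseteq> rank_level P i \<union> rank_level P (i + 1)"
proof -
  interpret pair_wf_digraph "cover_graph P i" by (rule wf_cover_graph)
  show "H \<in> comps i \<Longrightarrow> ?thesis"
    unfolding comps_def using sccs_verts_subsets[of H] by (simp add: cover_graph_def)
qed

lemma comps_subset_carrier: "H \<in> comps i \<Longrightarrow> H \<subseteq> P"
  using comps_subset[of H i] by (auto simp: rank_level_def)

lemma finite_comps: "finite (comps i)"
  by (rule finite_subset[of _ "Pow P"]) (use comps_subset_carrier fin in auto)

lemma comps_disjoint: "H \<in> comps i \<Longrightarrow> H' \<in> comps i \<Longrightarrow> x \<in> H \<Longrightarrow> x \<in> H' \<Longrightarrow> H = H'"
proof -
  interpret pair_wf_digraph "cover_graph P i" by (rule wf_cover_graph)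
  show "H \<in> comps i \<Longrightarrow> H' \<in> comps i \<Longrightarrow> x \<in> H \<Longrightarrow> x \<in> H' \<Longrightarrow> ?thesis"
    unfolding comps_def using sccs_verts_disjoint[of H H'] by blast
qed

lemma exists_comp: "x \<in> P \<Longrightarrow> rk x = i \<or> rk x = i + 1 \<Longrightarrow> \<exists>H\<in>comps i. x \<in> H"
proof -
  interpret pair_wf_digraph "cover_graph P i" by (rule wf_cover_graph)
  assume "x \<in> P" "rk x = i \<or> rk x = i + 1"
  then have "x \<in> pverts (cover_graph P i)" by (simp add: cover_graph_def rank_level_def)
  then show ?thesis
    unfolding comps_def
    by (intro bexI[of _ "scc_of x"] in_scc_of_self scc_of_in_sccs_verts) simp_all
qed

lemma cover_graph_arcs:
  "(x, y) \<in> parcs (cover_graph P i) \<longleftrightarrow> covers P y x \<and> rk x = i \<or> covers P x y \<and> rk y = i"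
  using rk_covers by (auto simp: cover_graph_def Let_def rank_level_def covers_def)

lemma comp_closed:
  assumes H: "H \<in> comps i" and cov: "covers P b a" and "rk a = i"
  shows "a \<in> H \<longleftrightarrow> b \<in> H"
proof -
  interpret pair_wf_digraph "cover_graph P i" by (rule wf_cover_graph)
  let ?G = "with_proj (cover_graph P i)"
  have "(a, b) \<in> parcs (cover_graph P i)" "(b, a) \<in> parcs (cover_graph P i)"
    using assms by (auto simp: cover_graph_arcs)
  then have "b \<rightarrow>\<^sup>*\<^bsub>?G\<^esub> a" "a \<rightarrow>\<^sup>*\<^bsub>?G\<^esub> b" by (auto intro: adj_reachable_trans)
  then show ?thesis using H unfolding comps_def in_sccs_verts_conv_reachable by blast
qed

text \<open>The step is an equivalence because a walk in the component may cross an edge in either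
  direction.\<close>

lemma comp_induct:
  assumes H: "H \<in> comps i" "a \<in> H" "b \<in> H" and "Q a"
    and step: "\<And>x y. covers P y x \<Longrightarrow> rk x = i \<Longrightarrow> Q x \<longleftrightarrow> Q y"
  shows "Q b"
proof -
  interpret pair_wf_digraph "cover_graph P i" by (rule wf_cover_graph)
  let ?G = "with_proj (cover_graph P i)"
  have "a \<rightarrow>\<^sup>*\<^bsub>?G\<^esub> b"
    using H unfolding comps_def in_sccs_verts_conv_reachable by blast
  then show ?thesis
  proof (induction rule: reachable_induct)
    case (step x y)
    then show ?case using assms(5) by (auto simp: cover_graph_arcs)
  qed (rule \<open>Q a\<close>)
qed

section \<open>Pivots of the components\<close>

definition pivot :: "nat \<Rightarrow> 'a set \<Rightarrow> 'a" where
  "pivot i H = (SOME b. b \<in> H \<and> rk b = i + 1)"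

text \<open>No component lies in rank \<open>i\<close> alone: for \<open>i < r\<close> an element of
  rank \<open>i\<close> has a cover, which belongs to the same component.\<close>

lemma pivot:
  assumes H: "H \<in> comps i" and "i < r"
  shows "pivot i H \<in> H" "rk (pivot i H) = i + 1"
proof -
  have "H \<noteq> {}" using H by (auto simp: comps_def pre_digraph.sccs_verts_def)
  then obtain x where x: "x \<in> H" by blast
  then have xP: "x \<in> P" using comps_subset_carrier[OF H] by blast
  have "\<exists>b. b \<in> H \<and> rk b = i + 1"
  proof (cases "rk x = i")
    case True
    then obtain y where y: "covers P y x" using exists_cover[OF xP] \<open>i < r\<close> by auto
    then show ?thesis using comp_closed[OF H y True] x rk_covers[OF y] True by auto
  next
    case False
    then show ?thesis using comps_subset[OF H] x by (auto simp: rank_level_def)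
  qed
  from someI_ex[OF this] show "pivot i H \<in> H" "rk (pivot i H) = i + 1"
    unfolding pivot_def by blast+
qed

definition pivots :: "'a set" where
  "pivots = (\<lambda>(i, H). pivot i H) ` Sigma {..<r} comps"

lemma pivots_subset: "pivots \<subseteq> P"
  using pivot(1) comps_subset_carrier by (fastforce simp: pivots_def)

text \<open>A pivot determines \<open>i\<close> by its rank, and then its component because
  components of the same graph are disjoint.\<close>

lemma card_pivots: "card pivots = (\<Sum>i<r. card (comps i))"
proof -
  have "inj_on (\<lambda>(i, H). pivot i H) (Sigma {..<r} comps)"
  proof (rule inj_onI, clarify)
    fix i H i' H'
    assume *: "i < r" "i' < r" "H \<in> comps i" "H' \<in> comps i'" "pivot i H = pivot i' H'"
    then have i: "i' = i" using pivot(2)[of H i] pivot(2)[of H' i'] by simp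
    then show "i = i' \<and> H = H'"
      using comps_disjoint[of H i H' "pivot i H"] pivot(1)[of H i] pivot(1)[of H' i'] * by simp
  qed
  then show ?thesis by (simp add: pivots_def card_image card_SigmaI finite_comps)
qed

section \<open>Balance equations\<close>

definition balanced :: "('a \<Rightarrow> nat) \<Rightarrow> bool" where
  "balanced u \<longleftrightarrow> (\<forall>i<r. \<forall>H\<in>comps i.
     (\<Sum>a\<in>H \<inter> rank_level P i. u a) = (\<Sum>b\<in>H \<inter> rank_level P (i + 1). u b))"

text \<open>\<open>C\<close> has one element in each of the two ranks, and one covers the other. So
  a component contains both or neither, and the two sums are both 1 or both 0.\<close>

lemma balanced_chain:
  assumes C: "C \<in> maximal_chains P"
  shows "balanced (\<lambda>x. of_bool (x \<in> C))"
  unfolding balanced_def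
proof (intro allI impI ballI)
  fix i H assume i: "i < r" and H: "H \<in> comps i"
  have CP: "C \<subseteq> P" using finite_maximal_chain[OF fin C] by auto
  have uniq: "\<exists>a\<in>C. rk a = j \<and> (\<forall>x\<in>C. rk x = j \<longrightarrow> x = a)" if "j \<le> r" for j
    using bij_betw_rk[OF C] that unfolding bij_betw_def inj_on_def
    by (smt (verit) atMost_iff image_iff)
  obtain a where a: "a \<in> C" "rk a = i" "\<forall>x\<in>C. rk x = i \<longrightarrow> x = a" using uniq[of i] i by auto
  obtain b where b: "b \<in> C" "rk b = i + 1" "\<forall>x\<in>C. rk x = i + 1 \<longrightarrow> x = b"
    using uniq[of "i + 1"] i by auto
  have "covers P b a" using maximal_chain_covers[OF C a(1) b(1)] a(2) b(2) by simp
  then have ab: "a \<in> H \<longleftrightarrow> b \<in> H" using comp_closed[OF H _ a(2)] by blast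
  have "finite H" using comps_subset_carrier[OF H] fin finite_subset by blast
  then have s: "(\<Sum>a\<in>H \<inter> rank_level P j. of_bool (a \<in> C)) = card (H \<inter> rank_level P j \<inter> C)" for j
    by (simp add: of_bool_def sum.If_cases)
  have "H \<inter> rank_level P i \<inter> C = H \<inter> {a}" "H \<inter> rank_level P (i + 1) \<inter> C = H \<inter> {b}"
    using a b CP unfolding rank_level_def by blast+
  moreover have "card (H \<inter> {a}) = card (H \<inter> {b})"
    using ab by (cases "a \<in> H") auto
  ultimately show "(\<Sum>a\<in>H \<inter> rank_level P i. of_bool (a \<in> C) :: nat) =
      (\<Sum>b\<in>H \<inter> rank_level P (i + 1). of_bool (b \<in> C))"
    unfolding s by presburger
qed

text \<open>Induction on the rank: in the balance equation of a component only the value at its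
  pivot is still open, since the rank below and the other elements of the layer are settled.\<close>

lemma balanced_eqI:
  assumes u: "balanced u" and v: "balanced v" and eq: "\<And>x. x \<in> P - pivots \<Longrightarrow> u x = v x"
    and x: "x \<in> P"
  shows "u x = v x"
  using x
proof (induction "rk x" arbitrary: x)
  case 0
  have "x \<notin> pivots" using 0 pivot(2) by (fastforce simp: pivots_def)
  then show ?case using eq 0 by blast
next
  case (Suc i)
  show ?case
  proof (cases "x \<in> pivots")
    case True
    then obtain j H where j: "j < r" "H \<in> comps j" "x = pivot j H" by (auto simp: pivots_def)
    have ji: "j = i" using pivot(2)[OF j(2,1)] j(3) Suc.hyps(2) by simp
    have H: "i < r" "H \<in> comps i" "x = pivot i H" "x \<in> H" using j ji pivot(1)[OF j(2,1)] by auto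
    let ?L = "H \<inter> rank_level P (i + 1)"
    have xL: "x \<in> ?L" using H(4) Suc.hyps(2) Suc.prems by (auto simp: rank_level_def)
    have fL: "finite ?L" using comps_subset_carrier[OF H(2)] fin finite_subset by blast
    have "(\<Sum>b\<in>?L. u b) = (\<Sum>a\<in>H \<inter> rank_level P i. u a)"
      using u H unfolding balanced_def by simp
    also have "\<dots> = (\<Sum>a\<in>H \<inter> rank_level P i. v a)"
      using Suc.hyps(1) by (intro sum.cong) (auto simp: rank_level_def)
    also have "\<dots> = (\<Sum>b\<in>?L. v b)"
      using v H unfolding balanced_def by simp
    finally have "u x + (\<Sum>b\<in>?L - {x}. u b) = v x + (\<Sum>b\<in>?L - {x}. v b)"
      using sum.remove[OF fL xL, of u] sum.remove[OF fL xL, of v] by simp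
    moreover have "(\<Sum>b\<in>?L - {x}. u b) = (\<Sum>b\<in>?L - {x}. v b)"
    proof (rule sum.cong[OF refl])
      fix b assume b: "b \<in> ?L - {x}"
      \<comment> \<open>A pivot \<open>b\<close> in this layer comes from a component of the same
        graph that contains \<open>b\<close>, hence from \<open>H\<close>, and would equal
        \<open>x\<close>.\<close>
      have "b \<notin> pivots"
      proof
        assume "b \<in> pivots"
        then obtain k H' where k: "k < r" "H' \<in> comps k" "b = pivot k H'" by (auto simp: pivots_def)
        have "k = i" using pivot(2)[OF k(2,1)] k(3) b by (auto simp: rank_level_def)
        then have "H' = H" using comps_disjoint[of H' i H b] k b H(2) pivot(1)[OF k(2,1)] by auto
        then show False using b k \<open>k = i\<close> H(3) by auto
      qed
      then show "u b = v b" using eq b by (auto simp: rank_level_def)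
    qed
    ultimately show ?thesis by simp
  qed (use eq Suc.prems in blast)
qed

section \<open>The lattice spanned by maximal chains and pivots\<close>

text \<open>Replacing the part of a maximal chain below a common cover shows that the initial segments
  ending in one component agree modulo \<open>L\<close>. Going down from the top rank, where an initial segment
  is a maximal chain, the pivots then bring every initial segment into \<open>L\<close>.\<close>

lemma indicator_in_chain_lattice:
  fixes L :: "('a \<Rightarrow> int) set"
  assumes add: "\<And>f g. f \<in> L \<Longrightarrow> g \<in> L \<Longrightarrow> (\<lambda>x. f x + g x) \<in> L"
    and diff: "\<And>f g. f \<in> L \<Longrightarrow> g \<in> L \<Longrightarrow> (\<lambda>x. f x - g x) \<in> L"
    and chain: "\<And>C. C \<in> maximal_chains P \<Longrightarrow> (\<lambda>x. of_bool (x \<in> C)) \<in> L"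
    and piv: "\<And>p. p \<in> pivots \<Longrightarrow> (\<lambda>x. of_bool (x = p)) \<in> L"
    and s: "s \<in> P"
  shows "(\<lambda>x. of_bool (x = s)) \<in> L"
proof -
  define below where "below a = maximal_chains {y \<in> P. y < a}" for a :: 'a
  define seg where "seg a C = (\<lambda>x. of_bool (x \<in> insert a C) :: int)" for a :: 'a and C
  have ex: "\<exists>C. C \<in> below a" for a unfolding below_def by (rule exists_maximal_chain)
  have seg_in: "insert a C \<in> below b" if "covers P b a" "C \<in> below a" for a b C
    using maximal_chain_insert_cover that unfolding below_def by blast
  have notin: "a \<notin> C" if "C \<in> below a" for a C
    using finite_chain(2)[of C "\<lambda>y. y < a"] that unfolding below_def by blast
  have cancel: "f \<in> L \<longleftrightarrow> g \<in> L" if "(\<lambda>x. f x - g x) \<in> L" for f g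
    using add[OF that, of g] diff[OF _ that, of f] by auto
  \<comment> \<open>Completing both chains by the same \<open>D\<close> above \<open>b\<close> gives
    maximal chains of \<open>P\<close>, and \<open>D\<close> cancels in the difference.\<close>
  have exchange: "(\<lambda>x. of_bool (x \<in> C) - of_bool (x \<in> C')) \<in> L"
    if b: "b \<in> P" and C: "C \<in> below b" "C' \<in> below b" for b C C'
  proof -
    obtain D where D: "D \<in> maximal_chains {y \<in> P. b \<le> y}" using exists_maximal_chain by blast
    have "(\<lambda>x. of_bool (x \<in> C \<union> D) - of_bool (x \<in> C' \<union> D)) \<in> L"
      using maximal_chain_glue(1)[OF b _ D] C unfolding below_def by (intro diff chain) auto
    moreover have "C \<inter> D = {}" "C' \<inter> D = {}"
      using maximal_chain_glue(2)[OF b _ D] C unfolding below_def by auto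
    then have "of_bool (x \<in> C \<union> D) - of_bool (x \<in> C' \<union> D) =
        (of_bool (x \<in> C) - of_bool (x \<in> C') :: int)" for x by auto
    ultimately show ?thesis by simp
  qed
  define good where "good a \<longleftrightarrow> (\<forall>C\<in>below a. seg a C \<in> L)" for a
  \<comment> \<open>With \<open>a\<close> and \<open>a'\<close> adjoined, both become maximal chains
    below the common cover \<open>b\<close>, so they can be exchanged.\<close>
  have good_cover: "seg a C \<in> L \<longleftrightarrow> seg a' C' \<in> L"
    if "covers P b a" "covers P b a'" "C \<in> below a" "C' \<in> below a'" for a a' b C C'
    unfolding seg_def
    by (rule cancel, rule exchange[of b])
      (use that seg_in in \<open>auto simp: covers_def\<close>)
  have good: "good a" if "a \<in> P" for a
    using that
  proof (induction "r - rk a" arbitrary: a rule: less_induct)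
    case less
    note aP = \<open>a \<in> P\<close>
    show ?case
    proof (cases "rk a = r")
      case True
      obtain D where D: "D \<in> maximal_chains {y \<in> P. a \<le> y}" using exists_maximal_chain by blast
      \<comment> \<open>At the top rank nothing lies above \<open>a\<close>, so an initial segment
        ending in \<open>a\<close> is already a maximal chain of \<open>P\<close>.\<close>
      have "card D = 1" "a \<in> D" using card_chain_above[OF aP D] base_mem_chain_above[OF aP D] True by auto
      then have "D = {a}" by (auto simp: card_1_singleton_iff)
      then have "insert a C \<in> maximal_chains P" if "C \<in> below a" for C
        using maximal_chain_glue(1)[OF aP _ D, of C] that unfolding below_def by simp
      then show ?thesis unfolding good_def seg_def using chain by blast
    next
      case False
      then have ar: "rk a < r" using rk_le[OF aP] by simp
      obtain H where H: "H \<in> comps (rk a)" "a \<in> H" using exists_comp[OF aP] by blast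
      define g where "g = pivot (rk a) H"
      have g: "g \<in> H" "rk g = rk a + 1" "g \<in> P" "g \<in> pivots"
        using pivot[OF H(1) ar] comps_subset_carrier[OF H(1)] H(1) ar by (auto simp: g_def pivots_def)
      obtain a' where a': "covers P g a'" using exists_covered_of_rk_pos g by fastforce
      have rk': "rk a' = rk a" using rk_covers[OF a'] g by simp
      have "a' \<in> H" using comp_closed[OF H(1) a' rk'] g by blast
      have gg: "good g" using less.hyps[of g] g ar by simp
      \<comment> \<open>Below rank \<open>r\<close> a cover exists, through which all segments
        ending in \<open>y'\<close> can be exchanged; so one of them in \<open>L\<close>
        suffices.\<close>
      have good_iff: "good y' \<longleftrightarrow> (\<exists>C\<in>below y'. seg y' C \<in> L)" if "y' \<in> P" "rk y' < r" for y'
        using exists_cover[OF that] good_cover ex unfolding good_def by blast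
      have "good a'"
      proof -
        obtain C where C: "C \<in> below a'" using ex by blast
        \<comment> \<open>Dropping the pivot \<open>g\<close> from a segment ending in
          \<open>g\<close> leaves one ending in \<open>a'\<close>, so goodness descends by one
          rank.\<close>
        have "seg g (insert a' C) \<in> L" using gg seg_in[OF a' C] unfolding good_def by blast
        from diff[OF this piv[OF g(4)]]
        have "(\<lambda>x. seg g (insert a' C) x - of_bool (x = g)) \<in> L" .
        moreover have "(\<lambda>x. seg g (insert a' C) x - of_bool (x = g)) = seg a' C"
          using notin[OF seg_in[OF a' C]] by (auto simp: seg_def)
        ultimately show ?thesis using good_iff[of a'] a' C rk' ar by (auto simp: covers_def)
      qed
      \<comment> \<open>On an upper vertex, \<open>Q\<close> reads goodness off the elements that it
        covers, which are all good or all not.\<close>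
      define Q where
        "Q y \<longleftrightarrow> (if rk y = rk a then good y else \<forall>x. covers P y x \<longrightarrow> good x)" for y
      have "Q a"
      proof (rule comp_induct[OF H(1) \<open>a' \<in> H\<close> H(2)])
        show "Q a'" using \<open>good a'\<close> rk' by (simp add: Q_def)
        fix x y assume xy: "covers P y x" "rk x = rk a"
        have same: "good x \<longleftrightarrow> good x'" if "covers P y x'" for x'
          using good_cover[OF xy(1) that] ex unfolding good_def by blast
        have "Q x \<longleftrightarrow> good x" using xy(2) by (simp add: Q_def)
        moreover have "Q y \<longleftrightarrow> (\<forall>x. covers P y x \<longrightarrow> good x)"
          using xy(2) rk_covers[OF xy(1)] by (simp add: Q_def)
        ultimately show "Q x \<longleftrightarrow> Q y" using xy(1) same by blast
      qed
      then show ?thesis by (simp add: Q_def)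
    qed
  qed
  obtain C where C: "C \<in> below s" using ex by blast
  have segs: "seg s C \<in> L" using good[OF s] C unfolding good_def by blast
  show ?thesis
  proof (cases "rk s = 0")
    case True
    then have "C = {}" using card_chain_below[OF s] finite_chain(1) C by (fastforce simp: below_def)
    then show ?thesis using segs by (simp add: seg_def)
  next
    case False
    then obtain t where t: "covers P s t" using exists_covered_of_rk_pos[OF s] by auto
    obtain D where D: "D \<in> below t" using ex by blast
    have "t \<in> P" using t by (simp add: covers_def)
    then have "seg t D \<in> L" using good D unfolding good_def by blast
    moreover have "seg s (insert t D) \<in> L" using good[OF s] seg_in[OF t D] unfolding good_def by blast
    \<comment> \<open>The two initial segments differ exactly by \<open>s\<close>.\<close>
    ultimately have "(\<lambda>x. seg s (insert t D) x - seg t D x) \<in> L" by (intro diff)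
    moreover have "(\<lambda>x. seg s (insert t D) x - seg t D x) = (\<lambda>x. of_bool (x = s))"
      using notin[OF seg_in[OF t D]] by (auto simp: seg_def)
    ultimately show ?thesis by simp
  qed
qed

end

section \<open>Prime ideals in algebras of polynomials\<close>

lemma poly_const_zero [simp]: "poly_const 0 = 0"
  by (simp add: poly_const_def)

lemma poly_const_one [simp]: "poly_const 1 = 1"
  by (simp add: poly_const_def)

lemma poly_const_add: "poly_const (a + b) = poly_const a + poly_const b"
  by (simp add: poly_const_def Poly_Mapping.single_add)

lemma poly_const_uminus: "poly_const (- a) = - poly_const a"
  by (simp add: poly_const_def Poly_Mapping.single_uminus)

lemma poly_const_mult: "poly_const (a * b) = poly_const a * poly_const b"
  by (simp add: poly_const_def Poly_Mapping.mult_single)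

lemma uminus_poly_ring: "\<ominus>\<^bsub>poly_ring\<^esub> f = - (f :: ('a \<Rightarrow>\<^sub>0 nat) \<Rightarrow>\<^sub>0 'k::field)"
proof -
  interpret cring "poly_ring :: (('a \<Rightarrow>\<^sub>0 nat) \<Rightarrow>\<^sub>0 'k) ring" by (rule cring_poly_ring)
  show ?thesis by (rule minus_equality) (simp_all add: poly_ring_def)
qed

lemma chain_monomial_eq_single:
  "chain_monomial C = Poly_Mapping.single (\<Sum>x\<in>C. Poly_Mapping.single x 1) 1"
  unfolding chain_monomial_def
  by (induction C rule: infinite_finite_induct) (simp_all add: poly_var_def Poly_Mapping.mult_single)

lemma lookup_sum_single:
  "finite C \<Longrightarrow> Poly_Mapping.lookup (\<Sum>x\<in>C. Poly_Mapping.single x 1) y = (of_bool (y \<in> C) :: nat)"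
  by (induction C rule: finite_induct) (auto simp: lookup_add lookup_single)

lemma sum_single_keys:
  "(\<Sum>u\<in>Poly_Mapping.keys f. Poly_Mapping.single u (Poly_Mapping.lookup f u)) = f"
  by (rule poly_mapping_eqI)
    (simp add: lookup_sum lookup_single when_def in_keys_iff)

text \<open>The map of monoid algebras induced by \<open>\<phi>\<close>: coefficients of monomials
  with equal image add up. Over a commutative semiring it preserves sums, products and 1 if
  \<open>\<phi>\<close> is additive with \<open>\<phi> 0 = 0\<close>.\<close>

definition map_exponents :: "('m \<Rightarrow> 'n) \<Rightarrow> ('m \<Rightarrow>\<^sub>0 'k) \<Rightarrow> 'n \<Rightarrow>\<^sub>0 'k::comm_monoid_add" where
  "map_exponents \<phi> f =
     (\<Sum>u\<in>Poly_Mapping.keys f. Poly_Mapping.single (\<phi> u) (Poly_Mapping.lookup f u))"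

text \<open>The support of a sum may shrink, so additivity is computed over a common finite superset
  of the supports.\<close>

lemma map_exponents_superset:
  "finite U \<Longrightarrow> Poly_Mapping.keys f \<subseteq> U \<Longrightarrow>
    map_exponents \<phi> f = (\<Sum>u\<in>U. Poly_Mapping.single (\<phi> u) (Poly_Mapping.lookup f u))"
  unfolding map_exponents_def by (rule sum.mono_neutral_left) (auto simp: in_keys_iff)

lemma map_exponents_zero [simp]: "map_exponents \<phi> 0 = 0"
  by (simp add: map_exponents_def)

lemma map_exponents_single [simp]:
  "map_exponents \<phi> (Poly_Mapping.single u c) = Poly_Mapping.single (\<phi> u) c"
  by (simp add: map_exponents_def)

lemma map_exponents_add: "map_exponents \<phi> (f + g) = map_exponents \<phi> f + map_exponents \<phi> g"
proof -
  let ?U = "Poly_Mapping.keys f \<union> Poly_Mapping.keys g"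
  have "map_exponents \<phi> (f + g) =
      (\<Sum>u\<in>?U. Poly_Mapping.single (\<phi> u) (Poly_Mapping.lookup (f + g) u))"
    by (rule map_exponents_superset) (use Poly_Mapping.keys_add[of f g] in auto)
  also have "\<dots> = map_exponents \<phi> f + map_exponents \<phi> g"
    by (simp add: map_exponents_superset[of ?U] lookup_add Poly_Mapping.single_add sum.distrib)
  finally show ?thesis .
qed

lemma map_exponents_sum: "map_exponents \<phi> (\<Sum>i\<in>I. f i) = (\<Sum>i\<in>I. map_exponents \<phi> (f i))"
  by (induction I rule: infinite_finite_induct) (simp_all add: map_exponents_add)

lemma map_exponents_mult:
  fixes \<phi> :: "'m::comm_monoid_add \<Rightarrow> 'n::comm_monoid_add" and f g :: "'m \<Rightarrow>\<^sub>0 'k::comm_semiring_1"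
  assumes \<phi>: "\<And>u v. \<phi> (u + v) = \<phi> u + \<phi> v"
  shows "map_exponents \<phi> (f * g) = map_exponents \<phi> f * map_exponents \<phi> g"
proof -
  have "map_exponents \<phi> (f * g) = map_exponents \<phi>
      ((\<Sum>u\<in>Poly_Mapping.keys f. Poly_Mapping.single u (Poly_Mapping.lookup f u)) *
       (\<Sum>v\<in>Poly_Mapping.keys g. Poly_Mapping.single v (Poly_Mapping.lookup g v)))"
    by (simp only: sum_single_keys)
  also have "\<dots> = map_exponents \<phi> f * map_exponents \<phi> g"
    by (simp only: sum_product map_exponents_sum Poly_Mapping.mult_single map_exponents_single \<phi>
        map_exponents_def[of \<phi> f] map_exponents_def[of \<phi> g])
  finally show ?thesis .
qed

lemma map_exponents_comp: "map_exponents \<psi> (map_exponents \<phi> f) = map_exponents (\<lambda>u. \<psi> (\<phi> u)) f"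
  by (simp add: map_exponents_def[of \<phi>] map_exponents_sum) (simp add: map_exponents_def)

text \<open>For \<open>s\<close> injective below \<open>n\<close>, the induced map on polynomials
  renames \<open>s i\<close> to \<open>i\<close> for \<open>i < n\<close> and sets all other
  variables to 1. The new names are linearly ordered; ordering the exponents accordingly shows that
  the target is a domain.\<close>

definition restrict_exponent :: "(nat \<Rightarrow> 'a) \<Rightarrow> nat \<Rightarrow> ('a \<Rightarrow>\<^sub>0 nat) \<Rightarrow> nat \<Rightarrow>\<^sub>0 nat" where
  "restrict_exponent s n u = (\<Sum>i<n. Poly_Mapping.single i (Poly_Mapping.lookup u (s i)))"

lemma lookup_restrict_exponent:
  "Poly_Mapping.lookup (restrict_exponent s n u) i = (if i < n then Poly_Mapping.lookup u (s i) else 0)"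
  by (simp add: restrict_exponent_def lookup_sum lookup_single when_def)

lemma restrict_exponent_add:
  "restrict_exponent s n (u + v) = restrict_exponent s n u + restrict_exponent s n v"
  by (rule poly_mapping_eqI) (simp add: lookup_restrict_exponent lookup_add)

lemma restrict_exponent_zero [simp]: "restrict_exponent s n 0 = 0"
  by (rule poly_mapping_eqI) (simp add: lookup_restrict_exponent)

text \<open>This factorization makes the kernels in \<open>krull_dim_ge\<close> decreasing.\<close>

lemma restrict_exponent_restrict_exponent:
  "n \<le> m \<Longrightarrow> restrict_exponent (\<lambda>i. i) n (restrict_exponent s m u) = restrict_exponent s n u"
  by (rule poly_mapping_eqI) (simp add: lookup_restrict_exponent)

section \<open>Prime ideals of a subalgebra\<close>

locale poly_subalgebra =
  fixes A :: "(('a \<Rightarrow>\<^sub>0 nat) \<Rightarrow>\<^sub>0 'k::field) set"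
  assumes add_closed: "f \<in> A \<Longrightarrow> g \<in> A \<Longrightarrow> f + g \<in> A"
    and uminus_closed: "f \<in> A \<Longrightarrow> - f \<in> A"
    and mult_closed: "f \<in> A \<Longrightarrow> g \<in> A \<Longrightarrow> f * g \<in> A"
    and const_closed: "poly_const c \<in> A"
begin

lemma one_closed: "1 \<in> A"
  using const_closed[of 1] by simp

lemma zero_closed: "0 \<in> A"
  using const_closed[of 0] by simp

lemma power_closed: "f \<in> A \<Longrightarrow> f ^ n \<in> A"
  by (induction n) (auto intro: one_closed mult_closed)

lemma sum_closed: "(\<And>i. i \<in> I \<Longrightarrow> f i \<in> A) \<Longrightarrow> sum f I \<in> A"
  by (induction I rule: infinite_finite_induct) (auto intro: zero_closed add_closed)

text \<open>Primality is spelled out in the operations of the type, so that later calculations avoid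
  the ring record.\<close>

definition prime_in :: "(('a \<Rightarrow>\<^sub>0 nat) \<Rightarrow>\<^sub>0 'k) set \<Rightarrow> bool" where
  "prime_in p \<longleftrightarrow> p \<subseteq> A \<and> 0 \<in> p \<and> 1 \<notin> p \<and> (\<forall>f\<in>p. \<forall>g\<in>p. f + g \<in> p) \<and>
     (\<forall>f\<in>A. \<forall>g\<in>p. f * g \<in> p) \<and> (\<forall>f\<in>A. \<forall>g\<in>A. f * g \<in> p \<longrightarrow> f \<in> p \<or> g \<in> p)"

lemma prime_inD:
  assumes "prime_in p"
  shows "p \<subseteq> A" "0 \<in> p" "1 \<notin> p"
    and "\<And>f g. f \<in> p \<Longrightarrow> g \<in> p \<Longrightarrow> f + g \<in> p"
    and "\<And>f g. f \<in> A \<Longrightarrow> g \<in> p \<Longrightarrow> f * g \<in> p"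
    and "\<And>f g. f \<in> A \<Longrightarrow> g \<in> A \<Longrightarrow> f * g \<in> p \<Longrightarrow> f \<in> p \<or> g \<in> p"
  using assms by (auto simp: prime_in_def)

lemma prime_in_power: "prime_in p \<Longrightarrow> f \<in> A \<Longrightarrow> f ^ n \<in> p \<Longrightarrow> f \<in> p"
  by (induction n) (auto dest: prime_inD(3) prime_inD(6)[of _ f "f ^ _"] intro: power_closed)

lemma prime_in_if_primeideal:
  assumes "primeideal p (poly_ring\<lparr>carrier := A\<rparr>)"
  shows "prime_in p"
proof -
  interpret primeideal p "poly_ring\<lparr>carrier := A\<rparr>" by fact
  have "1 \<notin> p" using one_imp_carrier I_notcarr by (auto simp: poly_ring_def)
  then show ?thesis
    using a_subset zero_closed additive_subgroup.zero_closed[OF is_additive_subgroup]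
      additive_subgroup.a_closed[OF is_additive_subgroup] I_l_closed I_prime
    unfolding prime_in_def by (auto simp: poly_ring_def)
qed

section \<open>Chains of primes and algebraic independence\<close>

text \<open>\<open>prime_flag p [x\<^sub>0, \<dots>, x\<^sub>n\<^sub>-\<^sub>1]\<close>: there are primes \<open>p = p\<^sub>0 \<subseteq> \<dots> \<subseteq> p\<^sub>n\<close> with \<open>x\<^sub>i \<in> p\<^sub>i\<^sub>+\<^sub>1 - p\<^sub>i\<close>.\<close>

inductive prime_flag :: "(('a \<Rightarrow>\<^sub>0 nat) \<Rightarrow>\<^sub>0 'k) set \<Rightarrow> (('a \<Rightarrow>\<^sub>0 nat) \<Rightarrow>\<^sub>0 'k) list \<Rightarrow> bool" where
  Nil: "prime_in p \<Longrightarrow> prime_flag p []"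
| Cons: "prime_in p \<Longrightarrow> prime_flag q xs \<Longrightarrow> p \<subseteq> q \<Longrightarrow> x \<in> q \<Longrightarrow> x \<notin> p \<Longrightarrow> prime_flag p (x # xs)"

lemma prime_flag_prime: "prime_flag p xs \<Longrightarrow> prime_in p"
  by (cases rule: prime_flag.cases) auto

lemma prime_flag_subset: "prime_flag p xs \<Longrightarrow> set xs \<subseteq> A"
proof (induction rule: prime_flag.induct)
  case (Cons p q xs x)
  then show ?case using prime_inD(1)[OF prime_flag_prime[OF Cons.hyps(2)]] by auto
qed simp

text \<open>Exponents form a list so that the induction along a flag can split off the power of its
  first element.\<close>

definition monom_list ::
  "(('a \<Rightarrow>\<^sub>0 nat) \<Rightarrow>\<^sub>0 'k) list \<Rightarrow> nat list \<Rightarrow> ('a \<Rightarrow>\<^sub>0 nat) \<Rightarrow>\<^sub>0 'k" where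
  "monom_list xs \<alpha> = prod_list (map2 (^) xs \<alpha>)"

lemma monom_list_simps [simp]:
  "monom_list [] \<alpha> = 1" "monom_list (x # xs) (n # \<alpha>) = x ^ n * monom_list xs \<alpha>"
  by (simp_all add: monom_list_def)

lemma monom_list_closed: "set xs \<subseteq> A \<Longrightarrow> monom_list xs \<alpha> \<in> A"
proof (induction xs arbitrary: \<alpha>)
  case (Cons x xs)
  then show ?case
    by (cases \<alpha>) (auto simp: monom_list_def[of _ "[]"] intro: one_closed mult_closed power_closed)
qed (simp add: one_closed)

text \<open>The lowest power of \<open>x\<^sub>0\<close> in a relation can be cancelled modulo \<open>p\<^sub>0\<close>; what remains is modulo
  \<open>p\<^sub>1\<close>, which contains \<open>x\<^sub>0\<close>, a shorter relation between \<open>x\<^sub>1, \<dots>, x\<^sub>n\<^sub>-\<^sub>1\<close>.\<close>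

lemma prime_flag_independent:
  assumes "prime_flag p xs" "finite F" "\<And>\<alpha>. \<alpha> \<in> F \<Longrightarrow> length \<alpha> = length xs"
    and "(\<Sum>\<alpha>\<in>F. poly_const (c \<alpha>) * monom_list xs \<alpha>) \<in> p" and "\<alpha> \<in> F"
  shows "c \<alpha> = 0"
  using assms
proof (induction arbitrary: F c \<alpha> rule: prime_flag.induct)
  case (Nil p)
  \<comment> \<open>Only the empty list has length 0, so the relation is a constant in
    \<open>p\<close>; a nonzero constant is a unit.\<close>
  then have "F = {[]}" "\<alpha> = []" by auto
  then have in_p: "poly_const (c []) \<in> p" using Nil by simp
  show ?case
  proof (rule ccontr)
    assume "c \<alpha> \<noteq> 0"
    then have "poly_const (inverse (c [])) * poly_const (c []) = 1"
      using \<open>\<alpha> = []\<close> by (simp flip: poly_const_mult)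
    then show False using prime_inD(5)[OF Nil(1) const_closed in_p] prime_inD(3)[OF Nil(1)] by metis
  qed
next
  case (Cons p q xs x)
  note q = prime_flag_prime[OF Cons.hyps(2)]
  have xA: "x \<in> A" using prime_inD(1)[OF q] Cons.hyps by blast
  have xsA: "set xs \<subseteq> A" using prime_flag_subset Cons.hyps by blast
  show ?case
  proof (rule ccontr)
    assume "c \<alpha> \<noteq> 0"
    define F' where "F' = {\<beta> \<in> F. c \<beta> \<noteq> 0}"
    have F': "finite F'" "F' \<noteq> {}" using Cons.prems \<open>c \<alpha> \<noteq> 0\<close> by (auto simp: F'_def)
    \<comment> \<open>The lowest power of \<open>x\<close> among the terms with nonzero
      coefficient.\<close>
    define m where "m = Min (hd ` F')"
    have m_le: "m \<le> hd \<beta>" if "\<beta> \<in> F'" for \<beta> using F' that by (simp add: m_def)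
    have "m \<in> hd ` F'" using F' unfolding m_def by (intro Min_in) auto
    define F1 where "F1 = {\<beta> \<in> F'. hd \<beta> = m}"
    have F1: "F1 \<noteq> {}" "finite F1" "F1 \<subseteq> F'" using \<open>m \<in> hd ` F'\<close> F' by (auto simp: F1_def)
    have split: "\<beta> = hd \<beta> # tl \<beta>" "length (tl \<beta>) = length xs" if "\<beta> \<in> F'" for \<beta>
      using Cons.prems(2)[of \<beta>] that by (cases \<beta>; simp add: F'_def)+
    have monom: "monom_list (x # xs) \<beta> = x ^ hd \<beta> * monom_list xs (tl \<beta>)" if "\<beta> \<in> F'" for \<beta>
      by (subst split(1)[OF that]) simp
    \<comment> \<open>The relation equals \<open>x ^ m * (x * S2 + S1)\<close>. Outside
      \<open>F1\<close> the first exponent exceeds \<open>m\<close>, so the truncated subtraction in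
      \<open>S2\<close> is exact.\<close>
    define S1 where "S1 = (\<Sum>\<beta>\<in>F1. poly_const (c \<beta>) * monom_list xs (tl \<beta>))"
    define S2 where "S2 =
      (\<Sum>\<beta>\<in>F' - F1. poly_const (c \<beta>) * (x ^ (hd \<beta> - m - 1) * monom_list xs (tl \<beta>)))"
    have S1A: "S1 \<in> A" unfolding S1_def
      by (intro sum_closed mult_closed const_closed monom_list_closed xsA)
    have S2A: "S2 \<in> A" unfolding S2_def
      by (intro sum_closed mult_closed const_closed monom_list_closed xsA power_closed xA)
    have "(\<Sum>\<alpha>\<in>F. poly_const (c \<alpha>) * monom_list (x # xs) \<alpha>) =
        (\<Sum>\<alpha>\<in>F'. poly_const (c \<alpha>) * monom_list (x # xs) \<alpha>)"
      by (rule sum.mono_neutral_right) (use Cons.prems in \<open>auto simp: F'_def\<close>)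
    also have "\<dots> = (\<Sum>\<alpha>\<in>F' - F1. poly_const (c \<alpha>) * monom_list (x # xs) \<alpha>) +
        (\<Sum>\<alpha>\<in>F1. poly_const (c \<alpha>) * monom_list (x # xs) \<alpha>)"
      by (rule sum.subset_diff[OF F1(3) F'(1)])
    also have "(\<Sum>\<alpha>\<in>F1. poly_const (c \<alpha>) * monom_list (x # xs) \<alpha>) = x ^ m * S1"
      unfolding S1_def sum_distrib_left
    proof (rule sum.cong[OF refl])
      fix \<beta> assume "\<beta> \<in> F1"
      then show "poly_const (c \<beta>) * monom_list (x # xs) \<beta> =
          x ^ m * (poly_const (c \<beta>) * monom_list xs (tl \<beta>))"
        using monom[of \<beta>] by (simp add: F1_def mult.left_commute)
    qed
    also have "(\<Sum>\<alpha>\<in>F' - F1. poly_const (c \<alpha>) * monom_list (x # xs) \<alpha>) = x ^ m * (x * S2)"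
      unfolding S2_def sum_distrib_left
    proof (rule sum.cong[OF refl])
      fix \<beta> assume \<beta>: "\<beta> \<in> F' - F1"
      then have "m < hd \<beta>" using m_le[of \<beta>] by (force simp: F1_def)
      then have "x ^ hd \<beta> = x ^ m * x * x ^ (hd \<beta> - m - 1)"
        by (auto simp: less_iff_Suc_add power_add)
      then show "poly_const (c \<beta>) * monom_list (x # xs) \<beta> =
          x ^ m * (x * (poly_const (c \<beta>) * (x ^ (hd \<beta> - m - 1) * monom_list xs (tl \<beta>))))"
        using monom[of \<beta>] \<beta> by (simp add: ac_simps)
    qed
    finally have "x ^ m * (x * S2 + S1) \<in> p" using Cons.prems(3) by (simp add: distrib_left)
    moreover have "x ^ m \<notin> p" using prime_in_power[OF Cons.hyps(1) xA] Cons.hyps by blast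
    ultimately have "x * S2 + S1 \<in> p"
      using prime_inD(6)[OF Cons.hyps(1) power_closed[OF xA] add_closed[OF mult_closed[OF xA S2A] S1A]]
      by blast
    then have "x * S2 + S1 \<in> q" using Cons.hyps by blast
    \<comment> \<open>As \<open>x\<close> lies in \<open>q\<close>, the part divisible by
      \<open>x\<close> drops out modulo \<open>q\<close>.\<close>
    moreover have "(- S2) * x \<in> q" using prime_inD(5)[OF q uminus_closed[OF S2A]] Cons.hyps by blast
    ultimately have "(x * S2 + S1) + (- S2) * x \<in> q" by (rule prime_inD(4)[OF q])
    then have "S1 \<in> q" by (simp add: mult.commute)
    \<comment> \<open>All lists in \<open>F1\<close> start with \<open>m\<close>, so their tails are
      distinct and index the shorter relation.\<close>
    have inj: "inj_on tl F1"
      by (rule inj_onI) (use split(1) F1(3) in \<open>metis (mono_tags, lifting) F1_def mem_Collect_eq\<close>)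
    have "(\<Sum>\<gamma>\<in>tl ` F1. poly_const (c (m # \<gamma>)) * monom_list xs \<gamma>) = S1"
      unfolding sum.reindex[OF inj] S1_def
      by (rule sum.cong[OF refl]) (use split(1) F1(3) in \<open>auto simp: F1_def\<close>)
    with \<open>S1 \<in> q\<close> have *: "(\<Sum>\<gamma>\<in>tl ` F1. poly_const (c (m # \<gamma>)) * monom_list xs \<gamma>) \<in> q"
      by simp
    obtain \<beta> where \<beta>: "\<beta> \<in> F1" using F1 by blast
    have "c (m # tl \<beta>) = 0"
      by (rule Cons.IH[OF _ _ *]) (use F1 \<beta> split(2) in auto)
    then show False using \<beta> split(1)[of \<beta>] by (simp add: F1_def F'_def)
  qed
qed

text \<open>Removing the least prime \<open>p\<close> leaves a chain with a flag starting at some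
  \<open>q\<close>. As \<open>q\<close> is strictly larger, an element of \<open>q\<close> outside
  \<open>p\<close> extends the flag.\<close>

lemma prime_flag_if_chain:
  assumes "finite \<C>" "\<C> \<noteq> {}" "subset.chain (Collect prime_in) \<C>"
  shows "\<exists>p\<in>\<C>. \<exists>xs. prime_flag p xs \<and> Suc (length xs) = card \<C>"
proof -
  have "\<exists>p\<in>\<C>. (\<forall>q\<in>\<C>. p \<subseteq> q) \<and> (\<exists>xs. prime_flag p xs \<and> Suc (length xs) = card \<C>)"
    using assms
  proof (induction "card \<C>" arbitrary: \<C>)
    case (Suc n)
    have chain: "\<And>p q. p \<in> \<C> \<Longrightarrow> q \<in> \<C> \<Longrightarrow> p \<subseteq> q \<or> q \<subseteq> p" "\<And>p. p \<in> \<C> \<Longrightarrow> prime_in p"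
      using Suc.prems(3) unfolding subset_chain_def by auto
    obtain p where p: "p \<in> \<C>" "\<And>q. q \<in> \<C> \<Longrightarrow> p \<subseteq> q"
      using finite_has_minimal[OF Suc.prems(1,2)] chain(1) by metis
    show ?case
    proof (cases "\<C> = {p}")
      case True
      then show ?thesis using prime_flag.Nil[OF chain(2)[OF p(1)]] by force
    next
      case False
      let ?D = "\<C> - {p}"
      have "n = card ?D" "finite ?D" "?D \<noteq> {}" "subset.chain (Collect prime_in) ?D"
        using Suc False p(1) by (auto simp: subset_chain_def)
      from Suc.hyps(1)[OF this] obtain q xs
        where q: "q \<in> ?D" "prime_flag q xs" "Suc (length xs) = card ?D" by blast
      have "p \<subset> q" using p q by blast
      then obtain x where "x \<in> q" "x \<notin> p" by blast
      then have "prime_flag p (x # xs)"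
        using prime_flag.Cons[OF chain(2)[OF p(1)] q(2)] \<open>p \<subset> q\<close> by blast
      moreover have "Suc (length (x # xs)) = card \<C>"
        using q(3) p(1) Suc.prems(1) Suc.hyps(2) \<open>n = card ?D\<close> by simp
      ultimately show ?thesis using p by blast
    qed
  qed simp
  then show ?thesis by blast
qed

section \<open>Counting monomials: the upper bound\<close>

definition exponents_le :: "'a set \<Rightarrow> nat \<Rightarrow> (('a \<Rightarrow>\<^sub>0 nat) \<Rightarrow>\<^sub>0 'k) \<Rightarrow> bool" where
  "exponents_le S k f \<longleftrightarrow> (\<forall>u\<in>Poly_Mapping.keys f. \<forall>s\<in>S. Poly_Mapping.lookup u s \<le> k)"

lemma exponents_le_mono: "exponents_le S k f \<Longrightarrow> k \<le> l \<Longrightarrow> exponents_le S l f"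
  unfolding exponents_le_def by (meson le_trans)

lemma exponents_le_one: "exponents_le S k 1"
  by (simp add: exponents_le_def)

lemma exponents_le_mult:
  assumes "exponents_le S k f" "exponents_le S l g"
  shows "exponents_le S (k + l) (f * g)"
  unfolding exponents_le_def
proof (intro ballI)
  fix w s assume "w \<in> Poly_Mapping.keys (f * g)" "s \<in> S"
  then obtain u v where "w = u + v" "u \<in> Poly_Mapping.keys f" "v \<in> Poly_Mapping.keys g"
    using Poly_Mapping.keys_mult[of f g] by blast
  then show "Poly_Mapping.lookup w s \<le> k + l"
    using assms \<open>s \<in> S\<close> unfolding exponents_le_def by (simp add: lookup_add add_mono)
qed

lemma exponents_le_power: "exponents_le S k f \<Longrightarrow> exponents_le S (n * k) (f ^ n)"
  by (induction n) (simp_all add: exponents_le_one exponents_le_mult)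

lemma exponents_le_monom_list:
  assumes "\<And>x. x \<in> set xs \<Longrightarrow> exponents_le S k x" "set \<alpha> \<subseteq> {..N}"
  shows "exponents_le S (length xs * (N * k)) (monom_list xs \<alpha>)"
  using assms
proof (induction xs arbitrary: \<alpha>)
  case (Cons x xs)
  show ?case
  proof (cases \<alpha>)
    case (Cons n \<beta>)
    have "exponents_le S (N * k) (x ^ n)"
      using exponents_le_power[of S k x n] Cons.prems Cons
      by (auto intro: exponents_le_mono mult_le_mono1)
    then show ?thesis
      using exponents_le_mult[OF _ Cons.IH[of \<beta>]] Cons.prems Cons by (simp add: add.commute)
  qed (simp add: monom_list_def exponents_le_one)
qed (simp add: exponents_le_one)

lemma exists_exponents_le:
  assumes "finite S"
  shows "\<exists>k. \<forall>x\<in>set xs. exponents_le S k x"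
proof -
  let ?B = "\<Union>x\<in>set xs. \<Union>u\<in>Poly_Mapping.keys x. Poly_Mapping.lookup u ` S"
  have "finite ?B"
    by (intro finite_UN_I finite_set finite_keys finite_imageI assms)
  then obtain k where k: "?B \<subseteq> {..k}" unfolding finite_nat_iff_bounded_le ..
  have "exponents_le S k x" if x: "x \<in> set xs" for x
    unfolding exponents_le_def
  proof (intro ballI)
    fix u s assume "u \<in> Poly_Mapping.keys x" "s \<in> S"
    then have "Poly_Mapping.lookup u s \<in> ?B" by (intro UN_I[OF x] UN_I) auto
    then have "Poly_Mapping.lookup u s \<in> {..k}" by (rule subsetD[OF k])
    then show "Poly_Mapping.lookup u s \<le> k" by simp
  qed
  then show ?thesis by blast
qed

lemma vector_space_poly: "vector_space (\<lambda>c f. poly_const c * f :: ('a \<Rightarrow>\<^sub>0 nat) \<Rightarrow>\<^sub>0 'k)"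
  by unfold_locales (simp_all add: algebra_simps poly_const_add poly_const_mult)

text \<open>The \<open>(N + 1)\<^sup>n\<close> monomials in a flag of length \<open>n\<close> with exponents at most \<open>N\<close> are linearly
  independent, but they lie in a space of dimension \<open>O(N\<^sup>d)\<close> with \<open>d = card S\<close>.\<close>

lemma prime_flag_length_le:
  assumes flag: "prime_flag p xs" and S: "finite S"
    and A: "\<And>f. f \<in> A \<Longrightarrow> Poly_Mapping.keys f \<subseteq> M"
    and inj: "\<And>u v. u \<in> M \<Longrightarrow> v \<in> M \<Longrightarrow>
      (\<And>s. s \<in> S \<Longrightarrow> Poly_Mapping.lookup u s = Poly_Mapping.lookup v s) \<Longrightarrow> u = v"
  shows "length xs \<le> card S"
proof (rule ccontr)
  assume "\<not> length xs \<le> card S"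
  then have len: "card S + 1 \<le> length xs" by simp
  interpret vs: vector_space "\<lambda>c f. poly_const c * f :: ('a \<Rightarrow>\<^sub>0 nat) \<Rightarrow>\<^sub>0 'k"
    by (rule vector_space_poly)
  note p = prime_flag_prime[OF flag]
  obtain k where k: "\<forall>x\<in>set xs. exponents_le S k x" using exists_exponents_le[OF S] by blast
  define n where "n = length xs"
  \<comment> \<open>With \<open>d = card S\<close>, the \<open>(N + 1) ^ n\<close> products lie in
    dimension at most \<open>((n * k + 1) * (N + 1)) ^ d\<close>. This \<open>N\<close> turns the
    bound into \<open>N * (N + 1) ^ d\<close>, which is below
    \<open>(N + 1) ^ (d + 1)\<close>.\<close>
  define N where "N = (n * k + 1) ^ card S"
  \<comment> \<open>Each of the \<open>n\<close> factors of a product contributes at most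
    \<open>N * k\<close> to an exponent.\<close>
  define K where "K = n * (N * k)"
  define box where "box = {\<alpha>. set \<alpha> \<subseteq> {..N} \<and> length \<alpha> = n}"
  have box: "finite box" "card box = (N + 1) ^ n"
    using finite_lists_length_eq[of "{..N}" n] card_lists_length_eq[of "{..N}" n]
    by (simp_all add: box_def)
  \<comment> \<open>Bounding the coordinates in \<open>S\<close> leaves finitely many exponents,
    since these coordinates determine an element of \<open>M\<close>.\<close>
  define U where "U = {u \<in> M. \<forall>s\<in>S. Poly_Mapping.lookup u s \<le> K}"
  have inj_restrict: "inj_on (\<lambda>u. restrict (Poly_Mapping.lookup u) S) U"
  proof (rule inj_onI)
    fix u v assume uv: "u \<in> U" "v \<in> U"
      "restrict (Poly_Mapping.lookup u) S = restrict (Poly_Mapping.lookup v) S"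
    show "u = v"
    proof (rule inj)
      show "Poly_Mapping.lookup u s = Poly_Mapping.lookup v s" if "s \<in> S" for s
        using fun_cong[OF uv(3), of s] that by simp
    qed (use uv in \<open>auto simp: U_def\<close>)
  qed
  have restrict_U: "(\<lambda>u. restrict (Poly_Mapping.lookup u) S) ` U \<subseteq> PiE S (\<lambda>_. {..K})"
    by (auto simp: U_def)
  have fin_PiE: "finite (PiE S (\<lambda>_. {..K}))" using S by (intro finite_PiE) auto
  have U: "finite U" "card U \<le> (K + 1) ^ card S"
    using inj_on_finite[OF inj_restrict restrict_U fin_PiE]
      card_inj_on_le[OF inj_restrict restrict_U fin_PiE] S by (simp_all add: card_PiE)
  define T where "T = (\<lambda>u. Poly_Mapping.single u (1::'k)) ` U"
  have T: "finite T" "card T \<le> (K + 1) ^ card S"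
    using U(1) order.trans[OF card_image_le[OF U(1)] U(2)] by (simp_all add: T_def)
  have span: "monom_list xs ` box \<subseteq> vs.span T"
  proof
    fix f assume "f \<in> monom_list xs ` box"
    then obtain \<alpha> where \<alpha>: "\<alpha> \<in> box" "f = monom_list xs \<alpha>" by blast
    have "exponents_le S K f"
      using exponents_le_monom_list[of xs S k \<alpha> N] k \<alpha> by (simp add: K_def n_def box_def)
    moreover have "Poly_Mapping.keys f \<subseteq> M"
      using A monom_list_closed[OF prime_flag_subset[OF flag]] \<alpha> by blast
    ultimately have "Poly_Mapping.keys f \<subseteq> U" by (auto simp: U_def exponents_le_def)
    then have "(\<Sum>u\<in>Poly_Mapping.keys f.
        poly_const (Poly_Mapping.lookup f u) * Poly_Mapping.single u 1) \<in> vs.span T"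
      by (intro vs.span_sum vs.span_scale vs.span_base) (auto simp: T_def)
    moreover have "poly_const c * Poly_Mapping.single u 1 = Poly_Mapping.single u c"
      for u :: "'a \<Rightarrow>\<^sub>0 nat" and c :: 'k
      by (simp add: poly_const_def Poly_Mapping.mult_single)
    ultimately show "f \<in> vs.span T" by (simp add: sum_single_keys)
  qed
  have len_box: "\<alpha> \<in> box \<Longrightarrow> length \<alpha> = length xs" for \<alpha> by (simp add: box_def n_def)
  \<comment> \<open>Independence concerns the set of products, so their number must be that of the
    exponent lists. Two equal products would give a relation with coefficients 1 and -1.\<close>
  have inj_box: "inj_on (monom_list xs) box"
  proof (rule inj_onI, rule ccontr)
    fix \<alpha> \<beta> assume *: "\<alpha> \<in> box" "\<beta> \<in> box" "monom_list xs \<alpha> = monom_list xs \<beta>" "\<alpha> \<noteq> \<beta>"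
    let ?c = "\<lambda>\<gamma>. if \<gamma> = \<alpha> then 1 else - 1 :: 'k"
    have "(\<Sum>\<gamma>\<in>{\<alpha>, \<beta>}. poly_const (?c \<gamma>) * monom_list xs \<gamma>) \<in> p"
      using * prime_inD(2)[OF p] by (simp add: poly_const_uminus)
    from prime_flag_independent[OF flag _ _ this, of \<alpha>] have "?c \<alpha> = 0"
      using len_box *(1,2) by blast
    then show False by simp
  qed
  have "vs.independent (monom_list xs ` box)"
    unfolding vs.independent_explicit_finite_subsets
  proof (intro allI impI ballI)
    fix V c f
    assume V: "V \<subseteq> monom_list xs ` box" "finite V" "(\<Sum>v\<in>V. poly_const (c v) * v) = 0" "f \<in> V"
    then obtain F where F: "F \<subseteq> box" "V = monom_list xs ` F" by (auto simp: subset_image_iff)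
    have "(\<Sum>\<alpha>\<in>F. poly_const (c (monom_list xs \<alpha>)) * monom_list xs \<alpha>) \<in> p"
      using V(3) prime_inD(2)[OF p] unfolding F(2)
      by (simp add: sum.reindex[OF inj_on_subset[OF inj_box F(1)]])
    note zero = prime_flag_independent[OF flag finite_subset[OF F(1) box(1)] _ this]
    obtain \<alpha> where "\<alpha> \<in> F" "f = monom_list xs \<alpha>" using V(4) F(2) by blast
    then show "c f = 0" using zero[of \<alpha>] len_box F(1) by blast
  qed
  from vs.independent_span_bound[OF T(1) this span]
  have "(N + 1) ^ n \<le> (K + 1) ^ card S"
    using T(2) box(2) by (simp add: card_image[OF inj_box])
  also have "\<dots> \<le> ((n * k + 1) * (N + 1)) ^ card S"
    by (rule power_mono) (simp_all add: K_def algebra_simps)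
  also have "\<dots> = N * (N + 1) ^ card S" by (simp only: power_mult_distrib N_def)
  also have "\<dots> < (N + 1) ^ (card S + 1)" by simp
  also have "\<dots> \<le> (N + 1) ^ n" using len by (intro power_increasing) (simp_all add: n_def)
  finally show False by simp
qed

lemma krull_dim_le:
  assumes S: "finite S"
    and A: "\<And>f. f \<in> A \<Longrightarrow> Poly_Mapping.keys f \<subseteq> M"
    and inj: "\<And>u v. u \<in> M \<Longrightarrow> v \<in> M \<Longrightarrow>
      (\<And>s. s \<in> S \<Longrightarrow> Poly_Mapping.lookup u s = Poly_Mapping.lookup v s) \<Longrightarrow> u = v"
  shows "krull_dim (poly_ring\<lparr>carrier := A\<rparr>) \<le> ereal (real (card S))"
  unfolding krull_dim_def
proof (rule SUP_least)
  fix \<C> assume "\<C> \<in> {\<C>. finite \<C> \<and> \<C> \<noteq> {} \<and>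
    subset.chain {I. primeideal I (poly_ring\<lparr>carrier := A\<rparr>)} \<C>}"
  then have "finite \<C>" "\<C> \<noteq> {}" "subset.chain (Collect prime_in) \<C>"
    using prime_in_if_primeideal by (auto simp: subset_chain_def)
  from prime_flag_if_chain[OF this] obtain p xs
    where flag: "prime_flag p xs" and len: "Suc (length xs) = card \<C>" by blast
  have "length xs \<le> card S" by (rule prime_flag_length_le[OF flag S A inj])
  then have "card \<C> \<le> card S + 1" using len by simp
  then show "ereal (real (card \<C>) - 1) \<le> ereal (real (card S))" by simp
qed

section \<open>Kernels of monomial maps: the lower bound\<close>

lemma cring_subalgebra: "cring (poly_ring\<lparr>carrier := A\<rparr>)"
proof -
  interpret R: cring "poly_ring :: (('a \<Rightarrow>\<^sub>0 nat) \<Rightarrow>\<^sub>0 'k) ring" by (rule cring_poly_ring)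
  have "subring A (poly_ring :: (('a \<Rightarrow>\<^sub>0 nat) \<Rightarrow>\<^sub>0 'k) ring)"
  proof (rule R.subringI)
    show "\<ominus>\<^bsub>poly_ring\<^esub> h \<in> A" if "h \<in> A" for h
      using uminus_closed[OF that] by (simp add: uminus_poly_ring)
  qed (auto simp: poly_ring_def intro: one_closed add_closed mult_closed)
  then have "subcring A (poly_ring :: (('a \<Rightarrow>\<^sub>0 nat) \<Rightarrow>\<^sub>0 'k) ring)"
    by (intro R.subcringI') (auto simp: poly_ring_def mult.commute)
  then show ?thesis using R.subcring_iff[of A] by (simp add: poly_ring_def)
qed

lemma domain_poly_ring: "domain (poly_ring :: ((nat \<Rightarrow>\<^sub>0 nat) \<Rightarrow>\<^sub>0 'k) ring)"
proof -
  interpret cring "poly_ring :: ((nat \<Rightarrow>\<^sub>0 nat) \<Rightarrow>\<^sub>0 'k) ring" by (rule cring_poly_ring)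
  show ?thesis by unfold_locales (auto simp: poly_ring_def)
qed

text \<open>This is the preimage of the zero ideal of a domain under the induced ring
  homomorphism.\<close>

lemma primeideal_kernel:
  fixes \<phi> :: "('a \<Rightarrow>\<^sub>0 nat) \<Rightarrow> (nat \<Rightarrow>\<^sub>0 nat)"
  assumes \<phi>: "\<And>u v. \<phi> (u + v) = \<phi> u + \<phi> v" "\<phi> 0 = 0"
  shows "primeideal {f \<in> A. map_exponents \<phi> f = 0} (poly_ring\<lparr>carrier := A\<rparr>)"
proof -
  interpret S: domain "poly_ring :: ((nat \<Rightarrow>\<^sub>0 nat) \<Rightarrow>\<^sub>0 'k) ring" by (rule domain_poly_ring)
  interpret R: cring "poly_ring\<lparr>carrier := A\<rparr>" by (rule cring_subalgebra)
  have one: "map_exponents \<phi> 1 = (1 :: (nat \<Rightarrow>\<^sub>0 nat) \<Rightarrow>\<^sub>0 'k)"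
    using map_exponents_single[of \<phi> 0 "1 :: 'k"] \<phi>(2) by simp
  interpret h: ring_hom_ring "poly_ring\<lparr>carrier := A\<rparr>"
    "poly_ring :: ((nat \<Rightarrow>\<^sub>0 nat) \<Rightarrow>\<^sub>0 'k) ring" "map_exponents \<phi>"
    by (rule ring_hom_ringI[OF R.ring_axioms S.ring_axioms])
      (simp_all add: poly_ring_def map_exponents_add map_exponents_mult[OF \<phi>(1)] one)
  show ?thesis
    using h.primeideal_vimage[OF R.is_cring S.zeroprimeideal] by (simp add: poly_ring_def)
qed

text \<open>The kernels of the maps that keep the first \<open>n\<close> coordinates of
  \<open>S\<close> form the chain. The difference of two monomials that disagree at a single
  coordinate of \<open>S\<close> vanishes until that coordinate is kept, so the inclusions are
  strict.\<close>

lemma krull_dim_ge: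
  assumes S: "finite S"
    and sep: "\<And>s. s \<in> S \<Longrightarrow> \<exists>u v. Poly_Mapping.single u 1 \<in> A \<and> Poly_Mapping.single v 1 \<in> A \<and>
      Poly_Mapping.lookup u s \<noteq> Poly_Mapping.lookup v s \<and>
      (\<forall>t\<in>S - {s}. Poly_Mapping.lookup u t = Poly_Mapping.lookup v t)"
  shows "krull_dim (poly_ring\<lparr>carrier := A\<rparr>) \<ge> ereal (real (card S))"
proof -
  obtain s where s: "bij_betw s {0..<card S} S" using ex_bij_betw_nat_finite[OF S] by blast
  define \<phi> where "\<phi> = restrict_exponent s"
  define p where "p n = {f \<in> A. map_exponents (\<phi> n) f = 0}" for n
  have prime: "primeideal (p n) (poly_ring\<lparr>carrier := A\<rparr>)" for n
    unfolding p_def \<phi>_def by (rule primeideal_kernel) (simp_all add: restrict_exponent_add)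
  have anti: "p m \<subseteq> p n" if "n \<le> m" for n m
  proof -
    have "map_exponents (\<phi> n) f = 0" if "map_exponents (\<phi> m) f = 0" for f :: "('a \<Rightarrow>\<^sub>0 nat) \<Rightarrow>\<^sub>0 'k"
      using map_exponents_comp[of "restrict_exponent (\<lambda>i. i) n" "\<phi> m" f] that \<open>n \<le> m\<close>
      by (simp add: \<phi>_def restrict_exponent_restrict_exponent)
    then show ?thesis by (auto simp: p_def)
  qed
  have strict: "p n \<noteq> p m" if nm: "n < m" "m \<le> card S" for n m
  proof -
    have sn: "s n \<in> S" using s nm by (auto simp: bij_betw_def)
    obtain u v where uv: "Poly_Mapping.single u 1 \<in> A" "Poly_Mapping.single v 1 \<in> A"
      "Poly_Mapping.lookup u (s n) \<noteq> Poly_Mapping.lookup v (s n)"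
      "\<forall>t\<in>S - {s n}. Poly_Mapping.lookup u t = Poly_Mapping.lookup v t"
      using sep[OF sn] by blast
    \<comment> \<open>\<open>\<phi> n\<close> keeps only coordinates before \<open>s n\<close>,
      where \<open>u\<close> and \<open>v\<close> agree; \<open>\<phi> m\<close> also keeps
      \<open>s n\<close>.\<close>
    have "\<phi> n u = \<phi> n v"
    proof (rule poly_mapping_eqI)
      fix i
      have "s i \<in> S - {s n}" if "i < n"
        using inj_onD[OF bij_betw_imp_inj_on[OF s], of i n] bij_betwE[OF s] that nm by auto
      then show "Poly_Mapping.lookup (\<phi> n u) i = Poly_Mapping.lookup (\<phi> n v) i"
        using uv(4) by (simp add: \<phi>_def lookup_restrict_exponent)
    qed
    moreover have "\<phi> m u \<noteq> \<phi> m v"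
      using uv(3) nm(1) lookup_restrict_exponent[of s m _ n] unfolding \<phi>_def by metis
    moreover have "map_exponents (\<phi> l) (Poly_Mapping.single u 1 + - Poly_Mapping.single v 1) =
        Poly_Mapping.single (\<phi> l u) (1 :: 'k) + - Poly_Mapping.single (\<phi> l v) 1" for l
      by (simp only: map_exponents_add map_exponents_single flip: Poly_Mapping.single_uminus)
    moreover have "Poly_Mapping.single (\<phi> m u) (1 :: 'k) \<noteq> Poly_Mapping.single (\<phi> m v) 1"
      using \<open>\<phi> m u \<noteq> \<phi> m v\<close> by (metis keys_single singleton_inject zero_neq_one)
    moreover have "Poly_Mapping.single u 1 + - Poly_Mapping.single v 1 \<in> A"
      by (intro add_closed uminus_closed uv)
    ultimately have "Poly_Mapping.single u 1 + - Poly_Mapping.single v 1 \<in> p n - p m"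
      by (simp add: p_def)
    then show ?thesis by blast
  qed
  have "inj_on p {..card S}"
    by (rule linorder_inj_onI) (use strict in auto)
  \<comment> \<open>The indices from 0 to \<open>card S\<close> give \<open>card S + 1\<close>
    primes, hence a chain of length \<open>card S\<close>.\<close>
  then have card: "card (p ` {..card S}) = card S + 1" by (simp add: card_image)
  have "subset.chain {I. primeideal I (poly_ring\<lparr>carrier := A\<rparr>)} (p ` {..card S})"
    using prime anti nat_le_linear unfolding subset_chain_def by blast
  then have "ereal (real (card (p ` {..card S})) - 1) \<le> krull_dim (poly_ring\<lparr>carrier := A\<rparr>)"
    unfolding krull_dim_def by (intro SUP_upper) auto
  then show ?thesis unfolding card by simp
qed

end

section \<open>The chain algebra\<close>

context pure_poset
begin

section \<open>Exponents occurring in the chain algebra\<close>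

definition chain_exponent :: "'a set \<Rightarrow> 'a \<Rightarrow>\<^sub>0 nat" where
  "chain_exponent C = (\<Sum>x\<in>C. Poly_Mapping.single x 1)"

lemma chain_monomial_eq: "chain_monomial C = Poly_Mapping.single (chain_exponent C) 1"
  by (simp only: chain_monomial_eq_single chain_exponent_def)

lemma lookup_chain_exponent:
  "C \<in> maximal_chains P \<Longrightarrow> Poly_Mapping.lookup (chain_exponent C) x = of_bool (x \<in> C)"
  unfolding chain_exponent_def by (rule lookup_sum_single[OF finite_maximal_chain(1)[OF fin]])

text \<open>The support is confined to \<open>P\<close> because the balance equations say nothing
  about variables outside \<open>P\<close>.\<close>

definition balanced_exponents :: "('a \<Rightarrow>\<^sub>0 nat) set" where
  "balanced_exponents = {u. Poly_Mapping.keys u \<subseteq> P \<and> balanced (Poly_Mapping.lookup u)}"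

lemma chain_exponent_balanced:
  assumes C: "C \<in> maximal_chains P"
  shows "chain_exponent C \<in> balanced_exponents"
proof -
  have "Poly_Mapping.lookup (chain_exponent C) = (\<lambda>x. of_bool (x \<in> C))"
    using lookup_chain_exponent[OF C] by blast
  moreover have "Poly_Mapping.keys (chain_exponent C) \<subseteq> P"
    using finite_maximal_chain(2)[OF fin C] by (auto simp: in_keys_iff lookup_chain_exponent[OF C])
  ultimately show ?thesis using balanced_chain[OF C] by (simp add: balanced_exponents_def)
qed

lemma zero_balanced: "0 \<in> balanced_exponents"
  by (simp add: balanced_exponents_def balanced_def)

lemma add_balanced:
  assumes "u \<in> balanced_exponents" "v \<in> balanced_exponents"
  shows "u + v \<in> balanced_exponents"
  using assms Poly_Mapping.keys_add[of u v]
  by (auto simp: balanced_exponents_def balanced_def lookup_add sum.distrib)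

text \<open>Provides, for \<open>S = P - pivots\<close>, the injectivity that
  \<open>krull_dim_le\<close> asks for.\<close>

lemma balanced_exponents_eqI:
  assumes u: "u \<in> balanced_exponents" and v: "v \<in> balanced_exponents"
    and eq: "\<And>x. x \<in> P - pivots \<Longrightarrow> Poly_Mapping.lookup u x = Poly_Mapping.lookup v x"
  shows "u = v"
proof (rule poly_mapping_eqI)
  fix x
  show "Poly_Mapping.lookup u x = Poly_Mapping.lookup v x"
  proof (cases "x \<in> P")
    case True
    show ?thesis
      by (rule balanced_eqI[of "Poly_Mapping.lookup u" "Poly_Mapping.lookup v", OF _ _ eq True])
        (use u v in \<open>simp_all add: balanced_exponents_def\<close>)
  next
    case False
    then have "x \<notin> Poly_Mapping.keys u" "x \<notin> Poly_Mapping.keys v"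
      using u v by (auto simp: balanced_exponents_def)
    then show ?thesis by (simp add: in_keys_iff)
  qed
qed

definition chain_carrier :: "(('a \<Rightarrow>\<^sub>0 nat) \<Rightarrow>\<^sub>0 'k::field) set" where
  "chain_carrier = generated_subalgebra (range poly_const) poly_ring
     (chain_monomial ` maximal_chains P)"

lemma chain_algebra_eq: "chain_algebra P = poly_ring\<lparr>carrier := chain_carrier\<rparr>"
  by (simp add: chain_algebra_def chain_carrier_def)

lemma chain_carrier_closed:
  fixes f g :: "('a \<Rightarrow>\<^sub>0 nat) \<Rightarrow>\<^sub>0 'k::field"
  shows "f \<in> chain_carrier \<Longrightarrow> g \<in> chain_carrier \<Longrightarrow> f + g \<in> chain_carrier"
    and "f \<in> chain_carrier \<Longrightarrow> g \<in> chain_carrier \<Longrightarrow> f * g \<in> chain_carrier"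
    and "f \<in> chain_carrier \<Longrightarrow> - f \<in> chain_carrier"
    and "1 \<in> (chain_carrier :: (('a \<Rightarrow>\<^sub>0 nat) \<Rightarrow>\<^sub>0 'k) set)"
    and "f \<in> chain_carrier \<Longrightarrow> poly_const c * f \<in> chain_carrier"
  unfolding chain_carrier_def generated_subalgebra_def hull_def
  using subringE(3,5,6,7)[of _ "poly_ring :: (('a \<Rightarrow>\<^sub>0 nat) \<Rightarrow>\<^sub>0 'k) ring"]
    subalgebra.smult_closed[of "range poly_const" _
      "poly_ring :: (('a \<Rightarrow>\<^sub>0 nat) \<Rightarrow>\<^sub>0 'k) ring" "poly_const c"]
  by (auto simp: uminus_poly_ring) (auto simp: poly_ring_def)

lemma poly_subalgebra_chain_carrier:
  "poly_subalgebra (chain_carrier :: (('a \<Rightarrow>\<^sub>0 nat) \<Rightarrow>\<^sub>0 'k::field) set)"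
proof
  show "poly_const c \<in> (chain_carrier :: (('a \<Rightarrow>\<^sub>0 nat) \<Rightarrow>\<^sub>0 'k) set)" for c
    using chain_carrier_closed(5)[OF chain_carrier_closed(4), of c] by simp
qed (rule chain_carrier_closed; assumption)+

lemma single_chain_exponent_in_carrier:
  "C \<in> maximal_chains P \<Longrightarrow> Poly_Mapping.single (chain_exponent C) 1 \<in> chain_carrier"
  unfolding chain_carrier_def generated_subalgebra_def
  by (rule hull_inc) (metis chain_monomial_eq imageI)

text \<open>Balanced exponents form a monoid, so the polynomials supported on them form a subalgebra
  \<open>B\<close>; it contains the generators.\<close>

lemma keys_chain_carrier:
  fixes f :: "('a \<Rightarrow>\<^sub>0 nat) \<Rightarrow>\<^sub>0 'k::field"
  assumes "f \<in> chain_carrier"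
  shows "Poly_Mapping.keys f \<subseteq> balanced_exponents"
proof -
  interpret R: cring "poly_ring :: (('a \<Rightarrow>\<^sub>0 nat) \<Rightarrow>\<^sub>0 'k) ring" by (rule cring_poly_ring)
  define B where "B = {f :: ('a \<Rightarrow>\<^sub>0 nat) \<Rightarrow>\<^sub>0 'k. Poly_Mapping.keys f \<subseteq> balanced_exponents}"
  have add: "f + g \<in> B" if "f \<in> B" "g \<in> B" for f g
    using that Poly_Mapping.keys_add[of f g] by (auto simp: B_def)
  have mult: "f * g \<in> B" if "f \<in> B" "g \<in> B" for f g
    using that Poly_Mapping.keys_mult[of f g] add_balanced unfolding B_def by blast
  have const: "poly_const c \<in> B" for c
    using zero_balanced by (simp add: B_def poly_const_def)
  have one: "1 \<in> B" using const[of 1] by simp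
  have uminus: "- f \<in> B" if "f \<in> B" for f
    using mult[OF const[of "- 1"] that] by (simp add: poly_const_uminus)
  have "subring B poly_ring"
    by (rule R.subringI) (use one add mult uminus in \<open>auto simp: uminus_poly_ring\<close>,
      auto simp: poly_ring_def)
  moreover have "subalgebra (range poly_const) B poly_ring"
  proof (intro subalgebra.intro subalgebra_axioms.intro)
    show "subgroup B (add_monoid poly_ring)"
      using \<open>subring B poly_ring\<close> by (rule subring.axioms(1))
    show "k \<otimes>\<^bsub>poly_ring\<^esub> v \<in> B" if "k \<in> range poly_const" "v \<in> B" for k v
      using that mult const by (auto simp: poly_ring_def)
  qed
  moreover have "chain_monomial ` maximal_chains P \<subseteq> B"
    using chain_exponent_balanced
    by (auto simp: B_def chain_monomial_eq)
  ultimately have "chain_carrier \<subseteq> B"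
    unfolding chain_carrier_def generated_subalgebra_def by (intro hull_minimal) auto
  then show ?thesis using assms by (auto simp: B_def)
qed

text \<open>Differences of exponents of monomials in the algebra, compared outside the pivots only,
  form a group \<open>L\<close> to which \<open>indicator_in_chain_lattice\<close> applies.\<close>

lemma separating_monomials:
  assumes s: "s \<in> P - pivots"
  shows "\<exists>u v. Poly_Mapping.single u (1 :: 'k::field) \<in> chain_carrier \<and>
    Poly_Mapping.single v (1 :: 'k) \<in> chain_carrier \<and>
    Poly_Mapping.lookup u s \<noteq> Poly_Mapping.lookup v s \<and>
    (\<forall>t\<in>P - pivots - {s}. Poly_Mapping.lookup u t = Poly_Mapping.lookup v t)"
proof -
  define Mon where "Mon = {u. Poly_Mapping.single u (1 :: 'k) \<in> chain_carrier}"
  have zero: "0 \<in> Mon" using chain_carrier_closed(4) by (simp add: Mon_def)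
  have plus: "u + v \<in> Mon" if "u \<in> Mon" "v \<in> Mon" for u v
    using chain_carrier_closed(2)[of "Poly_Mapping.single u (1 :: 'k)" "Poly_Mapping.single v 1"] that
    by (simp add: Mon_def Poly_Mapping.mult_single)
  define L where "L = {f :: 'a \<Rightarrow> int. \<exists>u\<in>Mon. \<exists>v\<in>Mon. \<forall>x\<in>P - pivots.
    f x = int (Poly_Mapping.lookup u x) - int (Poly_Mapping.lookup v x)}"
  have LI: "f \<in> L" if "u \<in> Mon" "v \<in> Mon"
    "\<And>x. x \<in> P - pivots \<Longrightarrow> f x = int (Poly_Mapping.lookup u x) - int (Poly_Mapping.lookup v x)" for f u v
    using that unfolding L_def by blast
  have "(\<lambda>x. of_bool (x = s)) \<in> L"
  proof (rule indicator_in_chain_lattice)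
    fix f g assume "f \<in> L" "g \<in> L"
    then obtain u v u' v' where *: "u \<in> Mon" "v \<in> Mon" "u' \<in> Mon" "v' \<in> Mon"
      "\<forall>x\<in>P - pivots. f x = int (Poly_Mapping.lookup u x) - int (Poly_Mapping.lookup v x)"
      "\<forall>x\<in>P - pivots. g x = int (Poly_Mapping.lookup u' x) - int (Poly_Mapping.lookup v' x)"
      unfolding L_def by blast
    show "(\<lambda>x. f x + g x) \<in> L"
      by (rule LI[OF plus[OF *(1,3)] plus[OF *(2,4)]]) (use * in \<open>simp add: lookup_add\<close>)
    \<comment> \<open>\<open>(u - v) - (u' - v')\<close> is written as
      \<open>(u + v') - (v + u')\<close>, a difference of two exponents again.\<close>
    show "(\<lambda>x. f x - g x) \<in> L"
      by (rule LI[OF plus[OF *(1,4)] plus[OF *(2,3)]]) (use * in \<open>simp add: lookup_add\<close>)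
  next
    fix C assume C: "C \<in> maximal_chains P"
    have "chain_exponent C \<in> Mon" using single_chain_exponent_in_carrier[OF C] by (simp add: Mon_def)
    then show "(\<lambda>x. of_bool (x \<in> C)) \<in> L"
      by (rule LI[OF _ zero]) (simp add: lookup_chain_exponent[OF C])
  next
    fix p assume "p \<in> pivots"
    \<comment> \<open>\<open>L\<close> constrains values outside the pivots only, and there this
      indicator is 0.\<close>
    then show "(\<lambda>x. of_bool (x = p)) \<in> L" by (intro LI[OF zero zero]) auto
  qed (use s in simp)
  then obtain u v where uv: "u \<in> Mon" "v \<in> Mon" "\<forall>x\<in>P - pivots. (of_bool (x = s) :: int) =
      int (Poly_Mapping.lookup u x) - int (Poly_Mapping.lookup v x)"
    unfolding L_def by blast
  have "Poly_Mapping.lookup u s \<noteq> Poly_Mapping.lookup v s" using bspec[OF uv(3) s] by auto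
  moreover have "Poly_Mapping.lookup u t = Poly_Mapping.lookup v t" if "t \<in> P - pivots - {s}" for t
    using bspec[OF uv(3), of t] that by simp
  ultimately show ?thesis using uv(1,2) unfolding Mon_def by blast
qed

lemma krull_dim_chain_algebra:
  "krull_dim (chain_algebra P :: (('a \<Rightarrow>\<^sub>0 nat) \<Rightarrow>\<^sub>0 'k::field) ring) = ereal (real (card (P - pivots)))"
proof -
  interpret A: poly_subalgebra "chain_carrier :: (('a \<Rightarrow>\<^sub>0 nat) \<Rightarrow>\<^sub>0 'k) set"
    by (rule poly_subalgebra_chain_carrier)
  have S: "finite (P - pivots)" using fin by simp
  show ?thesis
    unfolding chain_algebra_eq
    by (rule antisym[OF A.krull_dim_le[OF S keys_chain_carrier balanced_exponents_eqI]
          A.krull_dim_ge[OF S separating_monomials]])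
qed

end

theorem theorem6p2:
  fixes P :: "'a::order set" and r :: nat
  assumes "finite P"
    and "pure_of_rank P r"
  shows "krull_dim (chain_algebra P :: (('a \<Rightarrow>\<^sub>0 nat) \<Rightarrow>\<^sub>0 'k::field) ring) =
    ereal (real (card P) - (\<Sum>i<r. real (card (rank_components P i))))"
proof -
  interpret pure_poset P r using assms by unfold_locales
  have "card pivots \<le> card P" using pivots_subset fin by (rule card_mono[rotated])
  then have "real (card (P - pivots)) = real (card P) - real (card pivots)"
    using card_Diff_subset[OF finite_subset[OF pivots_subset fin] pivots_subset] by simp
  then show ?thesis by (simp add: krull_dim_chain_algebra card_pivots card_comps)
qed

end
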